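(* Let $I\subseteq\mathbb{R}$ be an interval, $(X,\mathbf{d})$ a metric space and $\gamma:I\to X$ a map. Then $\gamma$ is locally absolutely continuous if and only if $\gamma$ is locally of bounded variation and its speed measure $\nu$ is absolutely continuous with respect to Lebesgue measure $\lambda$ on $I$ (i.e. $\lambda(F)=0$ implies $\nu(F)=0$ for all Borel sets $F\subseteq I$).
   Context: An interval is a connected subset of $\mathbb{R}$. For $\gamma:I\to X$ and a subinterval $J\subseteq I$, $\operatorname{Var}(\gamma;J)\in[0,\infty]$ is the supremum of $\sum_{k=1}^n\mathbf{d}(\gamma(t_k),\gamma(t_{k+1}))$ over all $n\in\mathbb{N}$ and all $t_1\le t_2\le\dots\le t_{n+1}$ in $J$. $\gamma$ is locally of bounded variation if $\operatorname{Var}(\gamma;[a,b])<\infty$ for all $a\le b$ in $I$. Absolute continuity: a map $\gamma:I\to X$ is absolutely continuous if for every $\varepsilon>0$ there is $\delta>0$ such that for all finite families of pairwise disjoint subintervals $(a_k,b_k)$, $k=1,\dots,n$, with $a_k\le b_k$ in $I$, $\sum_{k=1}^n(b_k-a_k)\le\delta$ implies $\sum_{k=1}^n\mathbf{d}(\gamma(b_k),\gamma(a_k))\le\varepsilon$. $\gamma$ is locally absolutely continuous if $\gamma|_{[a,b]}$ is absolutely continuous for all $a\le b$ in $I$. Speed measure of $\gamma$ locally of bounded variation: with the convention $\operatorname{Var}(\gamma;[b,a]):=-\operatorname{Var}(\gamma;[a,b])$ for $a\le b$, fix $c\in I$ and set $\operatorname{V}_\gamma(t):=\operatorname{Var}(\gamma;[c,t])$,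 a nondecreasing real function on $I$. Let $\operatorname{v}(t):=\operatorname{V}_\gamma(t+)$ be its right limit at $t\in I$ (with $\operatorname{V}_\gamma(b+):=\operatorname{V}_\gamma(b)$ if $b=\sup I\in I$), and let $\mu_{\operatorname{v}}$ be the Lebesgue–Stieltjes measure on the Borel sets of $I$, characterized by $\mu_{\operatorname{v}}((s,t])=\operatorname{v}(t)-\operatorname{v}(s)$ for $s\le t$ in $I$ (and $\mu_{\operatorname{v}}(\{a\})=0$ if $a=\inf I\in I$). If $a=\inf I\in I$, the speed measure is $\nu:=\mu_{\operatorname{v}}+(\operatorname{V}_\gamma(a+)-\operatorname{V}_\gamma(a))\delta_a$; otherwise $\nu:=\mu_{\operatorname{v}}$. It does not depend on $c$. *)

theory Defs
  imports "HOL-Analysis.Analysis"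
begin

text \<open>
  A map from a real interval \<open>I\<close> to \<open>X\<close> is represented by a total function
  \<open>real \<Rightarrow> 'a::metric_space\<close>, of which only the values on \<open>I\<close> matter.
\<close>

definition Var :: "(real \<Rightarrow> 'a::metric_space) \<Rightarrow> real set \<Rightarrow> ennreal" where
  "Var \<gamma> J =
     (SUP (n, t) \<in> {(n::nat, t::nat \<Rightarrow> real). (\<forall>k\<in>{1..n+1}. t k \<in> J) \<and> mono_on {1..n+1} t}.
        ennreal (\<Sum>k=1..n. dist (\<gamma> (t k)) (\<gamma> (t (k+1)))))"

definition locally_bounded_variation :: "real set \<Rightarrow> (real \<Rightarrow> 'a::metric_space) \<Rightarrow> bool" where
  "locally_bounded_variation I \<gamma> \<longleftrightarrow> (\<forall>a\<in>I. \<forall>b\<in>I. a \<le> b \<longrightarrow> Var \<gamma> {a..b} < \<infinity>)"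

definition abs_continuous_on :: "real set \<Rightarrow> (real \<Rightarrow> 'a::metric_space) \<Rightarrow> bool" where
  "abs_continuous_on J \<gamma> \<longleftrightarrow>
     (\<forall>\<epsilon>>0. \<exists>\<delta>>0. \<forall>(n::nat) (a::nat \<Rightarrow> real) (b::nat \<Rightarrow> real).
        (\<forall>k\<in>{1..n}. a k \<in> J \<and> b k \<in> J \<and> a k \<le> b k) \<and>
        disjoint_family_on (\<lambda>k. {a k<..<b k}) {1..n} \<and>
        (\<Sum>k=1..n. b k - a k) \<le> \<delta>
        \<longrightarrow> (\<Sum>k=1..n. dist (\<gamma> (b k)) (\<gamma> (a k))) \<le> \<epsilon>)"

definition locally_abs_continuous :: "real set \<Rightarrow> (real \<Rightarrow> 'a::metric_space) \<Rightarrow> bool" where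
  "locally_abs_continuous I \<gamma> \<longleftrightarrow>
     (\<forall>a\<in>I. \<forall>b\<in>I. a \<le> b \<longrightarrow> abs_continuous_on {a..b} \<gamma>)"

text \<open>
  The real-valued functions and the measures below are meaningful only for \<open>\<gamma>\<close> locally of
  bounded variation and a base point \<open>c\<close> in \<open>I\<close>.
\<close>

definition variation_fun :: "(real \<Rightarrow> 'a::metric_space) \<Rightarrow> real \<Rightarrow> real \<Rightarrow> real" where
  "variation_fun \<gamma> c t =
     (if c \<le> t then enn2real (Var \<gamma> {c..t}) else - enn2real (Var \<gamma> {t..c}))"

definition right_limit_on :: "real set \<Rightarrow> (real \<Rightarrow> real) \<Rightarrow> real \<Rightarrow> real" where
  "right_limit_on I V t = (if \<forall>s\<in>I. s \<le> t then V t else Lim (at_right t) V)"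

text \<open>
  The Lebesgue--Stieltjes measure on the Borel sets of \<open>I\<close>. The library's \<open>interval_measure\<close>
  does not apply: a nondecreasing \<open>v\<close> on \<open>I\<close> may be unbounded near an endpoint not in \<open>I\<close>
  and then has no nondecreasing real-valued extension to the whole line. For \<open>v\<close>
  nondecreasing and right-continuous on the interval \<open>I\<close> the description below is satisfied by
  exactly one measure; the last clause settles the mass at a least element of \<open>I\<close>, which no
  \<open>{s<..t}\<close> with endpoints in \<open>I\<close> contains.
\<close>

definition stieltjes_measure_on :: "real set \<Rightarrow> (real \<Rightarrow> real) \<Rightarrow> real measure" where
  "stieltjes_measure_on I v =
     (THE M. sets M = sets (restrict_space borel I) \<and>
             (\<forall>s\<in>I. \<forall>t\<in>I. s \<le> t \<longrightarrow> emeasure M {s<..t} = ennreal (v t - v s)) \<and>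
             (\<forall>a\<in>I. (\<forall>s\<in>I. a \<le> s) \<longrightarrow> emeasure M {a} = 0))"

text \<open>
  The first case adds to \<open>\<mu>\<close> the point mass at the least element \<open>a\<close> of \<open>I\<close>.
  \<open>Inf I\<close> is unspecified for sets unbounded below, hence the explicit boundedness condition.
\<close>

definition speed_measure :: "real set \<Rightarrow> real \<Rightarrow> (real \<Rightarrow> 'a::metric_space) \<Rightarrow> real measure" where
  "speed_measure I c \<gamma> =
     (let V = variation_fun \<gamma> c;
          v = right_limit_on I V;
          \<mu> = stieltjes_measure_on I v;
          a = Inf I
      in if bdd_below I \<and> a \<in> I
         then measure_of (space \<mu>) (sets \<mu>)
                (\<lambda>F. emeasure \<mu> F + ennreal (v a - V a) * indicator F a)
         else \<mu>)"

end

theory Submission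
  imports Defs
begin

text \<open>
  If \<open>\<gamma>\<close> is locally absolutely continuous, then refining each interval of a small finite
  family shows that the total variation over the family is small, too. Hence \<open>V\<^sub>\<gamma>\<close> is
  continuous, \<open>\<nu>\<close> gives each compact interval its variation, and a null set, covered by
  countably many nonoverlapping intervals of small total length, has arbitrarily small
  \<open>\<nu>\<close>-measure. Conversely, \<open>\<nu>\<close> has no atoms if it is absolutely continuous, so
  \<open>V\<^sub>\<gamma>\<close> is continuous and \<open>d(\<gamma>(a), \<gamma>(b)) \<le> \<nu>((a, b])\<close>; by Borel--Cantelli,
  \<open>\<nu>\<close> is small on Borel subsets of a compact interval of small Lebesgue measure.
\<close>

text \<open>The half-open masses of \<nu> come from the right limit v of V: \<nu>((s, t]) = v(t) -
  v(s) can be read as the variation over [s, t] once v = V on I is known, so each direction proves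
  this equality before it estimates anything. In the converse, left continuity of v comes from the
  missing atoms, and v(w) \<le> V(x) for w < x squeezes v(x) down to V(x). At a least element a
  there is no such w; there v(a) - V(a) is the point mass that the speed measure adds, and it
  vanishes as the mass of a null set. Without that mass \<nu> would miss a jump of \<gamma> at a.
  \<nu> rests on a definite description, so nothing can be computed with it before existence and
  uniqueness of the Lebesgue-Stieltjes measure on I are settled. \<nu> may be infinite and I need
  not be compact. Every \<epsilon>-\<delta> argument therefore stays inside an interval with both
  ends in I; countably many of these, together with the least element if there is one, exhaust
  I.\<close>

section \<open>Variation and its additivity\<close>

lemma Var_upper:
  fixes t :: "nat \<Rightarrow> real"
  assumes "\<And>k. k \<in> {1..n+1} \<Longrightarrow> t k \<in> J" "mono_on {1..n+1} t"
  shows "ennreal (\<Sum>k=1..n. dist (\<gamma> (t k)) (\<gamma> (t (k+1)))) \<le> Var \<gamma> J"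
proof -
  have "(n, t) \<in> {(n::nat, t::nat \<Rightarrow> real). (\<forall>k\<in>{1..n+1}. t k \<in> J) \<and> mono_on {1..n+1} t}"
    using assms by auto
  then show ?thesis
    unfolding Var_def by (intro SUP_upper2[where i="(n, t)"]) simp_all
qed

lemma Var_least:
  assumes "\<And>(n::nat) (t::nat \<Rightarrow> real). \<lbrakk>\<And>k. k \<in> {1..n+1} \<Longrightarrow> t k \<in> J; mono_on {1..n+1} t\<rbrakk> \<Longrightarrow>
    ennreal (\<Sum>k=1..n. dist (\<gamma> (t k)) (\<gamma> (t (k+1)))) \<le> C"
  shows "Var \<gamma> J \<le> C"
  unfolding Var_def
proof (rule SUP_least, clarify)
  fix n and t :: "nat \<Rightarrow> real"
  assume "\<forall>k\<in>{1..n+1}. t k \<in> J" "mono_on {1..n+1} t"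
  then show "ennreal (\<Sum>k=1..n. dist (\<gamma> (t k)) (\<gamma> (t (k+1)))) \<le> C"
    by (intro assms) auto
qed

lemma dist_le_Var:
  assumes "s \<le> t"
  shows "ennreal (dist (\<gamma> s) (\<gamma> t)) \<le> Var \<gamma> {s..t}"
proof -
  have "ennreal (\<Sum>k=1..1. dist (\<gamma> (if k \<le> 1 then s else t)) (\<gamma> (if k + 1 \<le> (1::nat) then s else t)))
      \<le> Var \<gamma> {s..t}"
    using assms by (intro Var_upper) (auto simp: mono_on_def)
  then show ?thesis by simp
qed

lemma Var_singleton [simp]: "Var \<gamma> {a} = 0"
proof -
  have "Var \<gamma> {a} \<le> 0"
  proof (rule Var_least)
    fix n and t :: "nat \<Rightarrow> real"
    assume "\<And>k. k \<in> {1..n+1} \<Longrightarrow> t k \<in> {a}"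
    then have "(\<Sum>k=1..n. dist (\<gamma> (t k)) (\<gamma> (t (k+1)))) = 0"
      by (intro sum.neutral) auto
    then show "ennreal (\<Sum>k=1..n. dist (\<gamma> (t k)) (\<gamma> (t (k+1)))) \<le> 0"
      by simp
  qed
  then show ?thesis by simp
qed

lemma Var_add_le:
  assumes "a \<le> b" "b \<le> c"
  shows "Var \<gamma> {a..c} \<le> Var \<gamma> {a..b} + Var \<gamma> {b..c}"
proof (rule Var_least)
  fix n and t :: "nat \<Rightarrow> real"
  assume t: "\<And>k. k \<in> {1..n+1} \<Longrightarrow> t k \<in> {a..c}" "mono_on {1..n+1} t"
  \<comment> \<open>Clipping the partition at \<open>b\<close> avoids inserting \<open>b\<close> into it.\<close>
  define u w where "u = (\<lambda>k. min (t k) b)" and "w = (\<lambda>k. max (t k) b)"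
  have *: "dist (\<gamma> (t k)) (\<gamma> (t (k+1))) \<le>
      dist (\<gamma> (u k)) (\<gamma> (u (k+1))) + dist (\<gamma> (w k)) (\<gamma> (w (k+1)))" if "k \<in> {1..n}" for k
  proof -
    have "t k \<le> t (k+1)" using t(2) that by (auto simp: mono_on_def)
    then show ?thesis
      using dist_triangle[of "\<gamma> (t k)" "\<gamma> (t (k+1))" "\<gamma> b"]
      by (auto simp: u_def w_def min_def max_def)
  qed
  have mono: "mono_on {1..n+1} u" "mono_on {1..n+1} w"
    using t(2) by (fastforce simp: mono_on_def u_def w_def)+
  have "ennreal (\<Sum>k=1..n. dist (\<gamma> (t k)) (\<gamma> (t (k+1)))) \<le>
     ennreal ((\<Sum>k=1..n. dist (\<gamma> (u k)) (\<gamma> (u (k+1)))) + (\<Sum>k=1..n. dist (\<gamma> (w k)) (\<gamma> (w (k+1)))))"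
    unfolding sum.distrib[symmetric] by (intro ennreal_leI sum_mono *)
  also have "\<dots> = ennreal (\<Sum>k=1..n. dist (\<gamma> (u k)) (\<gamma> (u (k+1)))) +
      ennreal (\<Sum>k=1..n. dist (\<gamma> (w k)) (\<gamma> (w (k+1))))"
    by (intro ennreal_plus sum_nonneg) auto
  also have "\<dots> \<le> Var \<gamma> {a..b} + Var \<gamma> {b..c}"
    using t(1) assms mono by (intro add_mono Var_upper) (fastforce simp: u_def w_def)+
  finally show "ennreal (\<Sum>k=1..n. dist (\<gamma> (t k)) (\<gamma> (t (k+1)))) \<le> Var \<gamma> {a..b} + Var \<gamma> {b..c}" .
qed

text \<open>Partitions of the two halves are concatenated. Neither need contain b, so a junction
  term appears; it is nonnegative and is dropped.\<close>

lemma Var_add_ge: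
  assumes "a \<le> b" "b \<le> c"
  shows "Var \<gamma> {a..b} + Var \<gamma> {b..c} \<le> Var \<gamma> {a..c}"
proof -
  define P where "P J = {(n::nat, t::nat \<Rightarrow> real). (\<forall>k\<in>{1..n+1}. t k \<in> J) \<and> mono_on {1..n+1} t}" for J
  define S where "S = (\<lambda>(n::nat, t::nat \<Rightarrow> real). ennreal (\<Sum>k=1..n. dist (\<gamma> (t k)) (\<gamma> (t (k+1)))))"
  have S: "Var \<gamma> J = (SUP p\<in>P J. S p)" for J
    by (simp add: Var_def P_def S_def case_prod_unfold)
  have ne: "P {x..y} \<noteq> {}" if "x \<le> y" for x y
    using that by (auto simp: P_def mono_on_def intro!: exI[of _ "\<lambda>_. x"])
  have 1: "S p + S q \<le> Var \<gamma> {a..c}" if p: "p \<in> P {a..b}" and q: "q \<in> P {b..c}" for p q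
  proof -
    obtain n t m s where pq: "p = (n, t)" "q = (m, s)" by (metis surj_pair)
    have t: "t k \<in> {a..b}" if "k \<in> {1..n+1}" for k using p that by (auto simp: pq P_def)
    have s: "s k \<in> {b..c}" if "k \<in> {1..m+1}" for k using q that by (auto simp: pq P_def)
    have mono: "mono_on {1..n+1} t" "mono_on {1..m+1} s" using p q by (auto simp: pq P_def)
    \<comment> \<open>The n+1 points of \<open>t\<close> followed by the m+1 points of
      \<open>s\<close> make n+1+m steps; step n+1 is the junction from \<open>t (n+1)\<close> to
      \<open>s 1\<close>.\<close>
    define u where "u k = (if k \<le> n + 1 then t k else s (k - (n+1)))" for k
    define d where "d k = dist (\<gamma> (u k)) (\<gamma> (u (k+1)))" for k
    have ran: "u k \<in> {a..c}" if "k \<in> {1..n+1+m+1}" for k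
    proof (cases "k \<le> n + 1")
      case True
      then show ?thesis using t[of k] that assms by (auto simp: u_def)
    next
      case False
      then have "k - (n+1) \<in> {1..m+1}" using that by auto
      from s[OF this] show ?thesis using False assms by (auto simp: u_def)
    qed
    have mono_u: "mono_on {1..n+1+m+1} u"
    proof (rule mono_onI)
      fix i j assume ij: "i \<in> {1..n+1+m+1}" "j \<in> {1..n+1+m+1}" "i \<le> j"
      consider "j \<le> n+1" | "i \<le> n+1" "n+1 < j" | "n+1 < i" by linarith
      then show "u i \<le> u j"
      proof cases
        case 1 then show ?thesis using ij mono by (auto simp: u_def mono_on_def)
      next
        case 2
        then have "j - (n+1) \<in> {1..m+1}" using ij by auto
        from s[OF this] t[of i] have "u i \<le> b" "b \<le> u j" using 2 ij by (auto simp: u_def)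
        then show ?thesis by simp
      next
        case 3
        then have "s (i - (n+1)) \<le> s (j - (n+1))" using ij by (intro mono_onD[OF mono(2)]) auto
        then show ?thesis using 3 ij by (simp add: u_def)
      qed
    qed
    have *: "ennreal (\<Sum>k=1..n+1+m. d k) \<le> Var \<gamma> {a..c}"
      unfolding d_def by (intro Var_upper ran mono_u)
    have "(\<Sum>k=1..n+1+m. d k) = (\<Sum>k=1..n+1. d k) + (\<Sum>k=n+1+1..n+1+m. d k)"
      by (rule sum.ub_add_nat) simp
    also have "\<dots> = (\<Sum>k=1..n. d k) + d (n+1) + (\<Sum>k=1+(n+1)..m+(n+1). d k)"
      by (simp add: ac_simps)
    also have "(\<Sum>k=1+(n+1)..m+(n+1). d k) = (\<Sum>k=1..m. d (k+(n+1)))"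
      by (rule sum.shift_bounds_cl_nat_ivl)
    also have "\<dots> = (\<Sum>k=1..m. dist (\<gamma> (s k)) (\<gamma> (s (k+1))))"
      by (intro sum.cong) (auto simp: d_def u_def)
    also have "(\<Sum>k=1..n. d k) = (\<Sum>k=1..n. dist (\<gamma> (t k)) (\<gamma> (t (k+1))))"
      by (intro sum.cong) (auto simp: d_def u_def)
    finally have "(\<Sum>k=1..n. dist (\<gamma> (t k)) (\<gamma> (t (k+1)))) + (\<Sum>k=1..m. dist (\<gamma> (s k)) (\<gamma> (s (k+1))))
        \<le> (\<Sum>k=1..n+1+m. d k)" by (simp add: d_def)
    then have "S p + S q \<le> ennreal (\<Sum>k=1..n+1+m. d k)"
      by (simp add: S_def pq sum_nonneg ennreal_leI flip: ennreal_plus)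
    with * show ?thesis by order
  qed
  have "Var \<gamma> {a..b} + Var \<gamma> {b..c} = (SUP p\<in>P {a..b}. S p + Var \<gamma> {b..c})"
    unfolding S[of "{a..b}"] using ne[OF assms(1)] by (simp add: ennreal_SUP_add_left)
  also have "\<dots> = (SUP p\<in>P {a..b}. SUP q\<in>P {b..c}. S p + S q)"
    unfolding S[of "{b..c}"] using ne[OF assms(2)] by (simp add: ennreal_SUP_add_right)
  also have "\<dots> \<le> Var \<gamma> {a..c}" by (intro SUP_least 1)
  finally show ?thesis .
qed

lemma Var_add: "a \<le> b \<Longrightarrow> b \<le> c \<Longrightarrow> Var \<gamma> {a..c} = Var \<gamma> {a..b} + Var \<gamma> {b..c}"
  by (intro antisym Var_add_le Var_add_ge)

section \<open>Variation over small finite families of intervals\<close>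

text \<open>Suprema leave the sum one index at a time; the free summand \<open>c\<close> stores the
  terms already chosen during the induction. Sums of variations are bounded this way by choosing one
  partition for every interval at once.\<close>

lemma sum_SUP_ennreal_le:
  fixes f :: "'i \<Rightarrow> 'b \<Rightarrow> ennreal"
  assumes "finite K" "\<And>k. k \<in> K \<Longrightarrow> P k \<noteq> {}"
    and "\<And>p. (\<And>k. k \<in> K \<Longrightarrow> p k \<in> P k) \<Longrightarrow> c + (\<Sum>k\<in>K. f k (p k)) \<le> C"
  shows "c + (\<Sum>k\<in>K. SUP p\<in>P k. f k p) \<le> C"
  using assms
proof (induction K arbitrary: c rule: finite_induct)
  case empty
  then show ?case by simp
next
  case (insert k K)
  let ?S = "\<Sum>k\<in>K. SUP p\<in>P k. f k p"
  have "c + f k x + ?S \<le> C" if x: "x \<in> P k" for x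
  proof (rule insert.IH)
    fix p assume "\<And>k. k \<in> K \<Longrightarrow> p k \<in> P k"
    then have "c + (\<Sum>j\<in>insert k K. f j ((p(k := x)) j)) \<le> C"
      using x by (intro insert.prems) auto
    also have "(\<Sum>j\<in>insert k K. f j ((p(k := x)) j)) = f k x + (\<Sum>j\<in>K. f j ((p(k := x)) j))"
      using insert.hyps by simp
    also have "(\<Sum>j\<in>K. f j ((p(k := x)) j)) = (\<Sum>j\<in>K. f j (p j))"
      using insert.hyps by (intro sum.cong) auto
    finally show "c + f k x + (\<Sum>k\<in>K. f k (p k)) \<le> C" by (simp add: add.assoc)
  qed (use insert.prems in auto)
  then have "(SUP x\<in>P k. c + f k x + ?S) \<le> C" by (intro SUP_least)
  also have "(SUP x\<in>P k. c + f k x + ?S) = c + (SUP x\<in>P k. f k x) + ?S"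
    using insert.prems(1) by (simp add: ennreal_SUP_add_left ennreal_SUP_add_right)
  finally show ?case using insert.hyps by (simp add: add.assoc)
qed

text \<open>\<open>abs_continuous_on\<close> for one fixed pair \<delta>, \<epsilon>: the same pair
  serves when distances are replaced by variations.\<close>

definition small_variation_on :: "real set \<Rightarrow> (real \<Rightarrow> 'a::metric_space) \<Rightarrow> real \<Rightarrow> real \<Rightarrow> bool" where
  "small_variation_on J \<gamma> \<delta> \<epsilon> \<longleftrightarrow>
     (\<forall>(n::nat) (a::nat \<Rightarrow> real) (b::nat \<Rightarrow> real).
        (\<forall>k\<in>{1..n}. a k \<in> J \<and> b k \<in> J \<and> a k \<le> b k) \<and>
        disjoint_family_on (\<lambda>k. {a k<..<b k}) {1..n} \<and>
        (\<Sum>k=1..n. b k - a k) \<le> \<delta>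
        \<longrightarrow> (\<Sum>k=1..n. dist (\<gamma> (b k)) (\<gamma> (a k))) \<le> \<epsilon>)"

lemma abs_continuous_on_iff:
  "abs_continuous_on J \<gamma> \<longleftrightarrow> (\<forall>\<epsilon>>0. \<exists>\<delta>>0. small_variation_on J \<gamma> \<delta> \<epsilon>)"
  by (simp add: abs_continuous_on_def small_variation_on_def)

text \<open>Frees the index set from being \<open>{1..n}\<close>, because a refinement is naturally
  indexed by pairs of an interval and a step in it.\<close>

lemma small_variation_on_finite:
  fixes a b :: "'i \<Rightarrow> real"
  assumes sv: "small_variation_on J \<gamma> \<delta> \<epsilon>" and "finite K"
    and ab: "\<And>k. k \<in> K \<Longrightarrow> a k \<in> J \<and> b k \<in> J \<and> a k \<le> b k"
    and disj: "disjoint_family_on (\<lambda>k. {a k<..<b k}) K"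
    and le: "(\<Sum>k\<in>K. b k - a k) \<le> \<delta>"
  shows "(\<Sum>k\<in>K. dist (\<gamma> (b k)) (\<gamma> (a k))) \<le> \<epsilon>"
proof -
  obtain h where h: "bij_betw h {1..card K} K"
    using ex_bij_betw_nat_finite_1[OF \<open>finite K\<close>] by blast
  have hK: "h k \<in> K" if "k \<in> {1..card K}" for k using bij_betwE[OF h] that by blast
  have "(\<Sum>k=1..card K. dist (\<gamma> ((b \<circ> h) k)) (\<gamma> ((a \<circ> h) k))) \<le> \<epsilon>"
  proof (rule sv[unfolded small_variation_on_def, rule_format], intro conjI ballI)
    show "disjoint_family_on (\<lambda>k. {(a \<circ> h) k<..<(b \<circ> h) k}) {1..card K}"
      unfolding disjoint_family_on_def
    proof (intro ballI impI)
      fix i j assume ij: "i \<in> {1..card K}" "j \<in> {1..card K}" "i \<noteq> j"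
      then have "h i \<noteq> h j" using h by (metis bij_betw_def inj_onD)
      then show "{(a \<circ> h) i<..<(b \<circ> h) i} \<inter> {(a \<circ> h) j<..<(b \<circ> h) j} = {}"
        using disj hK[OF ij(1)] hK[OF ij(2)] unfolding disjoint_family_on_def comp_def by blast
    qed
    show "(\<Sum>k = 1..card K. (b \<circ> h) k - (a \<circ> h) k) \<le> \<delta>"
      using le sum.reindex_bij_betw[OF h, of "\<lambda>k. b k - a k"] by simp
  qed (use ab hK in auto)
  then show ?thesis
    using sum.reindex_bij_betw[OF h, of "\<lambda>k. dist (\<gamma> (b k)) (\<gamma> (a k))"] by simp
qed

text \<open>Refining does not increase the total length, so the bound \<epsilon> holds for every
  simultaneous choice of partitions. Being non-strict, it passes to the suprema without enlarging
  \<epsilon>.\<close>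

lemma small_variation_on_Var:
  fixes a b :: "'i \<Rightarrow> real"
  assumes sv: "small_variation_on J \<gamma> \<delta> \<epsilon>" and J: "is_interval J" and "finite K"
    and ab: "\<And>k. k \<in> K \<Longrightarrow> a k \<in> J \<and> b k \<in> J \<and> a k \<le> b k"
    and disj: "disjoint_family_on (\<lambda>k. {a k<..<b k}) K"
    and le: "(\<Sum>k\<in>K. b k - a k) \<le> \<delta>"
  shows "(\<Sum>k\<in>K. Var \<gamma> {a k..b k}) \<le> ennreal \<epsilon>"
proof -
  define P where "P J = {(n::nat, t::nat \<Rightarrow> real). (\<forall>k\<in>{1..n+1}. t k \<in> J) \<and> mono_on {1..n+1} t}" for J
  define S where "S = (\<lambda>(n::nat, t::nat \<Rightarrow> real). \<Sum>k=1..n. dist (\<gamma> (t k)) (\<gamma> (t (k+1))))"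
  have S: "Var \<gamma> J = (SUP p\<in>P J. ennreal (S p))" for J
    by (simp add: Var_def P_def S_def case_prod_unfold)
  have S0: "0 \<le> S p" for p by (auto simp: S_def case_prod_unfold intro: sum_nonneg)
  have "0 + (\<Sum>k\<in>K. SUP p\<in>P {a k..b k}. ennreal (S p)) \<le> ennreal \<epsilon>"
  proof (rule sum_SUP_ennreal_le)
    show "P {a k..b k} \<noteq> {}" if "k \<in> K" for k
      using ab[OF that] by (auto simp: P_def mono_on_def intro!: exI[of _ "\<lambda>_. a k"])
    fix p :: "'i \<Rightarrow> nat \<times> (nat \<Rightarrow> real)"
    assume p: "\<And>k. k \<in> K \<Longrightarrow> p k \<in> P {a k..b k}"
    define n where "n k = fst (p k)" for k
    define t where "t k = snd (p k)" for k
    have t: "t k j \<in> {a k..b k}" if "k \<in> K" "j \<in> {1..n k+1}" for k j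
      using p[OF that(1)] that(2) by (auto simp: P_def n_def t_def)
    have mono: "t k i \<le> t k j" if "k \<in> K" "1 \<le> i" "i \<le> j" "j \<le> n k + 1" for k i j
      using p[OF that(1)] that(2-) by (auto simp: P_def n_def t_def case_prod_unfold mono_on_def)
    \<comment> \<open>A pair in \<open>?K\<close> is an interval \<open>k\<close> with a step
      \<open>j\<close> of its partition. Two steps of one partition are disjoint by monotonicity,
      steps in different intervals because those have disjoint interiors.\<close>
    let ?A = "\<lambda>(k, j). t k j" and ?B = "\<lambda>(k, j). t k (j+1)" and ?K = "SIGMA k:K. {1..n k}"
    have "(\<Sum>q\<in>?K. dist (\<gamma> (?B q)) (\<gamma> (?A q))) \<le> \<epsilon>"
    proof (rule small_variation_on_finite[OF sv])
      show "finite ?K" using \<open>finite K\<close> by auto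
      show "?A q \<in> J \<and> ?B q \<in> J \<and> ?A q \<le> ?B q" if q: "q \<in> ?K" for q
      proof -
        obtain k j where kj: "q = (k, j)" "k \<in> K" "1 \<le> j" "j \<le> n k" using q by auto
        have "x \<in> J" if "x \<in> {a k..b k}" for x
          using mem_is_interval_1_I[OF J] ab[OF kj(2)] that by auto
        then show ?thesis using kj t[of k j] t[of k "j+1"] mono[of k j "j+1"] by auto
      qed
      have sub: "{t k j<..<t k (j+1)} \<subseteq> {a k<..<b k}" if "k \<in> K" "1 \<le> j" "j \<le> n k" for k j
        using t[of k j] t[of k "j+1"] that by auto
      have same: "{t k i<..<t k (i+1)} \<inter> {t k j<..<t k (j+1)} = {}"
        if "k \<in> K" "1 \<le> i" "i < j" "j \<le> n k" for k i j
        using mono[of k "i+1" j] that by auto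
      show "disjoint_family_on (\<lambda>q. {?A q<..<?B q}) ?K"
        unfolding disjoint_family_on_def
      proof (intro ballI impI)
        fix q r assume qr: "q \<in> ?K" "r \<in> ?K" "q \<noteq> r"
        obtain k j where q: "q = (k, j)" "k \<in> K" "1 \<le> j" "j \<le> n k" using qr by auto
        obtain l i where r: "r = (l, i)" "l \<in> K" "1 \<le> i" "i \<le> n l" using qr by auto
        show "{?A q<..<?B q} \<inter> {?A r<..<?B r} = {}"
        proof (cases "k = l")
          case True
          with qr q r have "i < j \<or> j < i" by auto
          then show ?thesis using same[of k i j] same[of k j i] q r True by auto
        next
          case False
          then have "{a k<..<b k} \<inter> {a l<..<b l} = {}"
            using disj q r by (auto simp: disjoint_family_on_def)
          then show ?thesis using sub[OF q(2-)] sub[OF r(2-)] unfolding q r prod.case by blast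
        qed
      qed
      have "(\<Sum>j=1..n k. t k (j+1) - t k j) \<le> b k - a k" if "k \<in> K" for k
        using sum_telescope''[of 1 "n k + 1" "t k"] t[of k 1] t[of k "n k + 1"] that
          sum_Suc_diff[of 1 "n k" "t k"] by simp
      then have "(\<Sum>k\<in>K. \<Sum>j=1..n k. t k (j+1) - t k j) \<le> \<delta>"
        by (intro order.trans[OF sum_mono le])
      then show "(\<Sum>q\<in>?K. ?B q - ?A q) \<le> \<delta>"
        using \<open>finite K\<close> by (simp add: sum.Sigma case_prod_unfold)
    qed
    also have "(\<Sum>q\<in>?K. dist (\<gamma> (?B q)) (\<gamma> (?A q))) = (\<Sum>k\<in>K. S (p k))"
      using \<open>finite K\<close>
      by (simp add: S_def sum.Sigma case_prod_unfold n_def t_def dist_commute)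
    finally show "0 + (\<Sum>k\<in>K. ennreal (S (p k))) \<le> ennreal \<epsilon>"
      by (simp add: sum_ennreal S0 ennreal_leI)
  qed fact
  then show ?thesis by (simp add: S)
qed

lemma small_variation_on_Var_interval:
  assumes "small_variation_on J \<gamma> \<delta> \<epsilon>" "is_interval J" "s \<in> J" "t \<in> J" "s \<le> t" "t - s \<le> \<delta>"
  shows "Var \<gamma> {s..t} \<le> ennreal \<epsilon>"
  using small_variation_on_Var[OF assms(1,2), of "{()}" "\<lambda>_. s" "\<lambda>_. t"] assms(3-)
  by (auto simp: disjoint_family_on_def)

text \<open>With \<delta> chosen for \<epsilon> = 1, each piece of length at most \<delta> adds at
  most 1, and finitely many pieces reach b.\<close>

lemma abs_continuous_on_Var_finite:
  assumes "abs_continuous_on {a..b} \<gamma>" "a \<le> b"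
  shows "Var \<gamma> {a..b} < \<infinity>"
proof -
  obtain \<delta> where \<delta>: "\<delta> > 0" "small_variation_on {a..b} \<gamma> \<delta> 1"
    using assms(1) unfolding abs_continuous_on_iff by (meson zero_less_one)
  have "Var \<gamma> {a..x} \<le> of_nat n" if "a \<le> x" "x \<le> b" "x \<le> a + of_nat n * \<delta>" for x and n :: nat
    using that
  proof (induction n arbitrary: x)
    case 0
    then have "x = a" by simp
    then show ?case by simp
  next
    case (Suc n)
    \<comment> \<open>The cut is capped at \<open>x\<close>, which may lie below
      \<open>a + of_nat n * \<delta>\<close>; the last piece is then degenerate.\<close>
    define y where "y = min x (a + of_nat n * \<delta>)"
    have y: "a \<le> y" "y \<le> x" "y \<le> a + of_nat n * \<delta>" "x - y \<le> \<delta>"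
      using Suc.prems \<delta> by (auto simp: y_def algebra_simps min_def)
    have "Var \<gamma> {a..x} = Var \<gamma> {a..y} + Var \<gamma> {y..x}" using y by (intro Var_add)
    also have "\<dots> \<le> of_nat n + ennreal 1"
      using y Suc.prems \<delta> by (intro add_mono Suc.IH small_variation_on_Var_interval) auto
    finally show ?case by (simp add: add.commute)
  qed
  moreover obtain n :: nat where "b - a < of_nat n * \<delta>"
    using ex_less_of_nat_mult[OF \<delta>(1)] by blast
  ultimately have "Var \<gamma> {a..b} \<le> of_nat n" using assms(2) by auto
  then show ?thesis using le_less_trans[OF _ of_nat_less_top[of n]] by (simp add: infinity_ennreal_def)
qed

section \<open>The variation function\<close>

text \<open>Finiteness turns additivity of \<open>Var\<close> into an equation between reals; the
  sign convention makes it hold wherever c lies relative to s and t, so the base point drops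
  out.\<close>

lemma variation_fun_diff:
  assumes "is_interval I" "locally_bounded_variation I \<gamma>" "c \<in> I" "s \<in> I" "t \<in> I" "s \<le> t"
  shows "variation_fun \<gamma> c t - variation_fun \<gamma> c s = enn2real (Var \<gamma> {s..t})"
proof -
  have fin: "Var \<gamma> {x..y} \<noteq> top" if "x \<in> I" "y \<in> I" "x \<le> y" for x y
    using assms(2) that unfolding locally_bounded_variation_def by (metis infinity_ennreal_def less_irrefl)
  have add: "enn2real (Var \<gamma> {x..z}) = enn2real (Var \<gamma> {x..y}) + enn2real (Var \<gamma> {y..z})"
    if "x \<in> I" "z \<in> I" "y \<in> I" "x \<le> y" "y \<le> z" for x y z
    using that fin[of x y] fin[of y z] by (simp add: Var_add[of x y z] enn2real_plus less_top)
  consider "c \<le> s" | "s < c" "c \<le> t" | "t < c" by linarith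
  then show ?thesis
  proof cases
    case 1
    with assms add[of c t s] show ?thesis by (simp add: variation_fun_def)
  next
    case 2
    with assms add[of s t c] show ?thesis by (simp add: variation_fun_def)
  next
    case 3
    with assms add[of s c t] show ?thesis by (simp add: variation_fun_def)
  qed
qed

lemma ennreal_variation_fun_diff:
  assumes "is_interval I" "locally_bounded_variation I \<gamma>" "c \<in> I" "s \<in> I" "t \<in> I" "s \<le> t"
  shows "ennreal (variation_fun \<gamma> c t - variation_fun \<gamma> c s) = Var \<gamma> {s..t}"
  using variation_fun_diff[OF assms] assms by (simp add: locally_bounded_variation_def)

lemma mono_on_variation_fun:
  assumes "is_interval I" "locally_bounded_variation I \<gamma>" "c \<in> I"
  shows "mono_on I (variation_fun \<gamma> c)"
proof (rule mono_onI)
  fix s t assume "s \<in> I" "t \<in> I" "s \<le> t"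
  from variation_fun_diff[OF assms this] enn2real_nonneg[of "Var \<gamma> {s..t}"]
  show "variation_fun \<gamma> c s \<le> variation_fun \<gamma> c t" by linarith
qed

section \<open>Right limits of monotone functions on an interval\<close>

context
  fixes I :: "real set" and V :: "real \<Rightarrow> real"
  assumes I: "is_interval I" and V: "mono_on I V"
begin

text \<open>The limit runs over all reals to the right of t, but V is controlled only on I. Since I
  contains [t, u], both filters agree near t, and a monotone function tends to its infimum.\<close>

lemma right_limit_on_eq_Inf:
  assumes "t \<in> I" "u \<in> I" "t < u"
  shows "right_limit_on I V t = Inf (V ` ({t<..} \<inter> I))"
proof -
  have "{t<..} \<inter> {..<u} - {t} = ({t<..} \<inter> I) \<inter> {..<u} - {t}"
    using mem_is_interval_1_I[OF I assms(1,2)] by auto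
  then have at: "at t within ({t<..} \<inter> I) = at_right t"
    using assms by (intro at_within_nhd[where S="{..<u}"]) auto
  have "(V \<longlongrightarrow> Inf (V ` ({t<..} \<inter> I))) (at t within ({t<..} \<inter> I))"
    using V assms(1) by (intro Lim_right_bound[where K="V t"]) (auto simp: mono_on_def)
  then have "Lim (at_right t) V = Inf (V ` ({t<..} \<inter> I))"
    unfolding at by (intro tendsto_Lim) auto
  then show ?thesis
    using assms by (auto simp: right_limit_on_def)
qed

lemma bdd_below_image_greaterThan:
  assumes "t \<in> I"
  shows "bdd_below (V ` ({t<..} \<inter> I))"
  using V assms by (intro bdd_belowI[of _ "V t"]) (auto simp: mono_on_def)

lemma right_limit_on_le:
  assumes "t \<in> I" "u \<in> I" "t < u"
  shows "right_limit_on I V t \<le> V u"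
  unfolding right_limit_on_eq_Inf[OF assms]
  using assms by (intro cInf_lower bdd_below_image_greaterThan) auto

lemma le_right_limit_on:
  assumes "t \<in> I"
  shows "V t \<le> right_limit_on I V t"
proof (cases "\<exists>u\<in>I. t < u")
  case True
  then obtain u where u: "u \<in> I" "t < u" by blast
  show ?thesis
    unfolding right_limit_on_eq_Inf[OF assms u]
    using V assms u by (intro cInf_greatest) (auto simp: mono_on_def)
next
  case False
  then show ?thesis by (auto simp: right_limit_on_def not_less)
qed

lemma mono_on_right_limit_on: "mono_on I (right_limit_on I V)"
proof (rule mono_onI)
  fix s t assume "s \<in> I" "t \<in> I" "s \<le> t"
  then show "right_limit_on I V s \<le> right_limit_on I V t"
    using right_limit_on_le[of s t] le_right_limit_on[of t] by (cases "s = t") auto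
qed

text \<open>Right continuity of the right limit in pure order form, as the generalized inverse in
  the construction of the measure needs it.\<close>

lemma right_limit_on_less_imp_ex:
  assumes "t \<in> I" "right_limit_on I V t < y" "u \<in> I" "t < u"
  obtains w where "w \<in> I" "t < w" "right_limit_on I V w < y"
proof -
  have "\<exists>x\<in>V ` ({t<..} \<inter> I). x < y"
    using assms by (intro cInf_lessD) (auto simp: right_limit_on_eq_Inf)
  then obtain x where x: "t < x" "x \<in> I" "V x < y" by auto
  \<comment> \<open>A point strictly below \<open>x\<close> is needed, since the right limit at
    \<open>x\<close> itself may exceed \<open>V x\<close>.\<close>
  define w where "w = (t + x) / 2"
  have w: "t < w" "w < x" using x by (auto simp: w_def)
  then have "w \<in> I" using mem_is_interval_1_I[OF I assms(1) x(2)] by auto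
  moreover have "right_limit_on I V w < y" using right_limit_on_le[of w x] \<open>w \<in> I\<close> x w by auto
  ultimately show thesis using that w by blast
qed

lemma right_limit_on_eqI:
  assumes "t \<in> I" and "\<And>u \<epsilon>. u \<in> I \<Longrightarrow> t < u \<Longrightarrow> \<epsilon> > 0 \<Longrightarrow> \<exists>w\<in>I. t < w \<and> V w \<le> V t + \<epsilon>"
  shows "right_limit_on I V t = V t"
proof (cases "\<exists>u\<in>I. t < u")
  case True
  then obtain u where u: "u \<in> I" "t < u" by blast
  have "right_limit_on I V t \<le> V t + \<epsilon>" if "\<epsilon> > 0" for \<epsilon>
    using assms(2)[OF u that] right_limit_on_le[OF assms(1)] by force
  then have "right_limit_on I V t \<le> V t" by (rule field_le_epsilon)
  then show ?thesis using le_right_limit_on[OF assms(1)] by simp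
next
  case False
  then show ?thesis by (auto simp: right_limit_on_def not_less)
qed

end

section \<open>Existence and uniqueness of the Lebesgue-Stieltjes measure\<close>

text \<open>The condition under the description operator of \<open>stieltjes_measure_on\<close>,
  named so that existence and uniqueness can be stated apart.\<close>

definition is_stieltjes_measure_on :: "real set \<Rightarrow> (real \<Rightarrow> real) \<Rightarrow> real measure \<Rightarrow> bool" where
  "is_stieltjes_measure_on I v M \<longleftrightarrow>
     sets M = sets (restrict_space borel I) \<and>
     (\<forall>s\<in>I. \<forall>t\<in>I. s \<le> t \<longrightarrow> emeasure M {s<..t} = ennreal (v t - v s)) \<and>
     (\<forall>a\<in>I. (\<forall>s\<in>I. a \<le> s) \<longrightarrow> emeasure M {a} = 0)"

text \<open>
  The measure is the image of Lebesgue measure on the range of \<open>v\<close> under the generalized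
  inverse of \<open>v\<close>; no gluing of compact pieces is needed when \<open>v\<close> is unbounded near an
  end of \<open>I\<close>.
\<close>

lemma is_stieltjes_measure_on_quantile:
  fixes v :: "real \<Rightarrow> real"
  assumes I: "is_interval I" and v: "mono_on I v"
    and rc: "\<And>t u y. \<lbrakk>t \<in> I; v t < y; u \<in> I; t < u\<rbrakk> \<Longrightarrow> \<exists>w\<in>I. t < w \<and> v w < y"
  defines "J \<equiv> {y. \<exists>s\<in>I. \<exists>t\<in>I. v s < y \<and> y \<le> v t}"
    and "q \<equiv> \<lambda>y. Inf {t\<in>I. y \<le> v t}"
  shows "is_stieltjes_measure_on I v (distr (restrict_space lborel J) (restrict_space borel I) q)"
proof -
  have J: "is_interval J"
    unfolding is_interval_1 J_def by (auto; meson le_less_trans less_le_trans order.trans)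
  then have J_borel: "J \<in> sets borel" by (rule real_interval_borel_measurable)
  \<comment> \<open>A Galois connection between \<open>q\<close> and \<open>v\<close>. It makes
    \<open>q\<close> monotone, hence measurable, and turns the preimage of (s, t] into (v s, v t],
    whose length is the required mass.\<close>
  have q: "q y \<in> I \<and> (\<forall>t\<in>I. q y \<le> t \<longleftrightarrow> y \<le> v t)" if "y \<in> J" for y
  proof -
    define A where "A = {t\<in>I. y \<le> v t}"
    obtain s t where st: "s \<in> I" "t \<in> I" "v s < y" "y \<le> v t" using \<open>y \<in> J\<close> by (auto simp: J_def)
    have lower: "w \<le> x" if "w \<in> I" "v w < y" "x \<in> A" for w x
      using that mono_onD[OF v, of x w] by (fastforce simp: A_def)
    have bdd: "bdd_below A" using lower[OF st(1,3)] by (intro bdd_belowI)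
    have "t \<in> A" using st by (simp add: A_def)
    have le: "q y \<le> x" if "x \<in> A" for x
      unfolding q_def A_def[symmetric] using that bdd by (rule cInf_lower)
    have ge: "w \<le> q y" if "w \<in> I" "v w < y" for w
      unfolding q_def A_def[symmetric] using lower[OF that] \<open>t \<in> A\<close> by (intro cInf_greatest) auto
    have qI: "q y \<in> I"
      using mem_is_interval_1_I[OF I st(1,2)] ge[OF st(1,3)] le[OF \<open>t \<in> A\<close>] by blast
    have vq: "y \<le> v (q y)"
    \<comment> \<open>The infimum is attained by right continuity: otherwise some point beyond
      \<open>q y\<close> would still be a lower bound of \<open>A\<close>.\<close>
    proof (rule ccontr)
      assume "\<not> y \<le> v (q y)"
      then have *: "v (q y) < y" by simp
      then have "q y < t" using le[OF \<open>t \<in> A\<close>] st(4) by (cases "q y = t") auto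
      from rc[OF qI * st(2) this] obtain w where "w \<in> I" "q y < w" "v w < y" by blast
      then show False using ge[of w] by simp
    qed
    have "q y \<le> x \<longleftrightarrow> y \<le> v x" if "x \<in> I" for x
      using le[of x] mono_onD[OF v qI that] vq that by (auto simp: A_def)
    with qI show ?thesis by blast
  qed
  have "mono_on J q"
    by (rule mono_onI) (meson q order.trans order.refl)
  then have "q \<in> borel_measurable (restrict_space lborel J)"
    using borel_measurable_mono_on_fnc
    by (simp cong: measurable_cong_sets sets_restrict_space_cong)
  then have meas: "q \<in> measurable (restrict_space lborel J) (restrict_space borel I)"
    using q by (intro measurable_restrict_space2) (auto simp: space_restrict_space)
  let ?M = "distr (restrict_space lborel J) (restrict_space borel I) q"
  have M: "emeasure ?M A = emeasure lborel (q -` A \<inter> J)" if "A \<subseteq> I" "A \<in> sets borel" for A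
    using that meas J_borel real_interval_borel_measurable[OF I]
    by (simp add: emeasure_distr sets_restrict_space_iff space_restrict_space emeasure_restrict_space)
  have "emeasure ?M {s<..t} = ennreal (v t - v s)" if "s \<in> I" "t \<in> I" "s \<le> t" for s t
  proof -
    have "{s<..t} \<subseteq> I" using mem_is_interval_1_I[OF I that(1,2)] by auto
    then have "emeasure ?M {s<..t} = emeasure lborel (q -` {s<..t} \<inter> J)" by (intro M) auto
    also have "q -` {s<..t} \<inter> J = {v s<..v t}"
    proof (intro equalityI subsetI)
      fix y assume "y \<in> q -` {s<..t} \<inter> J"
      then show "y \<in> {v s<..v t}" using q[of y] that by (auto simp flip: not_le)
    next
      fix y assume y: "y \<in> {v s<..v t}"
      then have "y \<in> J" using that by (auto simp: J_def)
      then show "y \<in> q -` {s<..t} \<inter> J" using q[of y] y that by (auto simp flip: not_le)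
    qed
    finally show ?thesis using mono_onD[OF v that] by simp
  qed
  moreover have "emeasure ?M {a} = 0" if "a \<in> I" "\<forall>s\<in>I. a \<le> s" for a
  proof -
    \<comment> \<open>\<open>J\<close> demands a value of \<open>v\<close> strictly below
      \<open>y\<close>, whereas \<open>q y = a\<close> forces \<open>y \<le> v a\<close>, the least
      value of \<open>v\<close>.\<close>
    have "y \<notin> J" if "q y = a" for y
    proof
      assume "y \<in> J"
      then obtain s where "s \<in> I" "v s < y" by (auto simp: J_def)
      moreover from this have "v a \<le> v s" using mono_onD[OF v] \<open>a \<in> I\<close> \<open>\<forall>s\<in>I. a \<le> s\<close> by blast
      moreover have "y \<le> v a" using q[OF \<open>y \<in> J\<close>] \<open>a \<in> I\<close> that by blast
      ultimately show False by simp
    qed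
    then have "q -` {a} \<inter> J = {}" by auto
    then show ?thesis using M[of "{a}"] that by simp
  qed
  ultimately show ?thesis by (simp add: is_stieltjes_measure_on_def)
qed

text \<open>The rationals in I suffice, except that a greatest element must be added to dominate
  itself. Below, strictness is required because (s, t] omits s; this leaves a least element as the
  only exception.\<close>

lemma interval_countable_cofinal:
  fixes I :: "real set"
  assumes I: "is_interval I"
  obtains D where "countable D" "D \<subseteq> I" "\<And>x. x \<in> I \<Longrightarrow> \<exists>t\<in>D. x \<le> t"
    "\<And>x. x \<in> I \<Longrightarrow> (\<forall>s\<in>I. x \<le> s) \<or> (\<exists>s\<in>D. s < x)"
proof
  let ?D = "I \<inter> \<rat> \<union> {x\<in>I. \<forall>s\<in>I. s \<le> x}"
  have "{x\<in>I. \<forall>s\<in>I. s \<le> x} \<subseteq> {Sup I}"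
    by (auto intro!: cSup_eq_maximum[symmetric])
  then have "countable {x\<in>I. \<forall>s\<in>I. s \<le> x}" by (rule countable_subset) simp
  then show "countable ?D" by (simp add: countable_rat countable_Int2)
  show "?D \<subseteq> I" by auto
  have rat: "\<exists>r\<in>I \<inter> \<rat>. x < r \<and> r < y" if "x \<in> I" "y \<in> I" "x < y" for x y
    using Rats_dense_in_real[OF \<open>x < y\<close>] mem_is_interval_1_I[OF I that(1,2)] by force
  show "\<exists>t\<in>?D. x \<le> t" if "x \<in> I" for x
  proof (cases "\<forall>s\<in>I. s \<le> x")
    case True
    with that show ?thesis by auto
  next
    case False
    then obtain y where "y \<in> I" "x < y" by (auto simp: not_le)
    with rat[OF that] obtain r where "r \<in> I \<inter> \<rat>" "x < r" by blast
    then show ?thesis by (intro bexI[of _ r]) auto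
  qed
  show "(\<forall>s\<in>I. x \<le> s) \<or> (\<exists>s\<in>?D. s < x)" if "x \<in> I" for x
  proof (cases "\<forall>s\<in>I. x \<le> s")
    case False
    then obtain y where "y \<in> I" "y < x" by (auto simp: not_le)
    with rat[of y x] that obtain r where "r \<in> I \<inter> \<rat>" "r < x" by blast
    then have "\<exists>s\<in>?D. s < x" by (intro bexI[of _ r]) auto
    then show ?thesis ..
  qed simp
qed

text \<open>The prescribed values live on an intersection-stable generator \<open>E\<close> of the
  Borel sets of I, and the members of \<open>E\<close> with ends in \<open>D\<close>, together with
  the least point, are a countable cover by sets of finite mass.\<close>

lemma is_stieltjes_measure_on_unique:
  assumes I: "is_interval I"
    and M: "is_stieltjes_measure_on I v M" and N: "is_stieltjes_measure_on I v N"
  shows "M = N"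
proof -
  obtain D where D: "countable D" "D \<subseteq> I" "\<And>x. x \<in> I \<Longrightarrow> \<exists>t\<in>D. x \<le> t"
    "\<And>x. x \<in> I \<Longrightarrow> (\<forall>s\<in>I. x \<le> s) \<or> (\<exists>s\<in>D. s < x)"
    using interval_countable_cofinal[OF I] by metis
  \<comment> \<open>At most one set, the singleton of the least element; a family avoids a case
    distinction on whether that element exists.\<close>
  define B where "B = (\<lambda>a. {a}) ` {a\<in>I. \<forall>s\<in>I. a \<le> s}"
  define E where "E = (\<lambda>(s, t). {s<..t}) ` {(s, t). s \<in> I \<and> t \<in> I \<and> s \<le> t} \<union> B"
  have "{a\<in>I. \<forall>s\<in>I. a \<le> s} \<subseteq> {Inf I}" by (auto intro!: cInf_eq_minimum[symmetric])
  then have "countable {a\<in>I. \<forall>s\<in>I. a \<le> s}" by (rule countable_subset) simp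
  then have B: "countable B" unfolding B_def by (rule countable_image)
  have EI: "{s<..t} \<in> E" if "s \<in> I" "t \<in> I" "s \<le> t" for s t using that by (auto simp: E_def)
  have Ioc: "{s<..t} \<subseteq> I" if "s \<in> I" "t \<in> I" for s t
    using mem_is_interval_1_I[OF I that] by auto
  then have E_sub: "E \<subseteq> Pow I" by (auto simp: E_def B_def)
  have I_borel: "I \<in> sets borel" using I by (rule real_interval_borel_measurable)
  have sets: "sets (restrict_space borel I) = sigma_sets I E"
  proof (rule antisym)
    have "E \<subseteq> sets (restrict_space borel I)"
      using E_sub I_borel by (auto simp: sets_restrict_space_iff E_def B_def)
    from sets.sigma_sets_subset[OF this] show "sigma_sets I E \<subseteq> sets (restrict_space borel I)"
      by (simp add: space_restrict_space)
    have atMost: "I \<inter> {..x} \<in> sigma_sets I E" for x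
    proof (cases "x \<in> I")
      case True
      have "I \<inter> {..x} = \<Union>((\<lambda>s. {s<..x}) ` {s\<in>D. s \<le> x} \<union> B)" (is "_ = \<Union>?U")
      proof (intro equalityI subsetI)
        fix y assume "y \<in> I \<inter> {..x}"
        then show "y \<in> \<Union>?U" using D(4)[of y] by (auto simp: B_def)
      next
        have "{s<..x} \<subseteq> I \<inter> {..x}" if "s \<in> D" for s
          using Ioc[OF _ True, of s] D(2) that by auto
        moreover have "\<Union>B \<subseteq> I \<inter> {..x}" using True by (auto simp: B_def)
        moreover fix y assume "y \<in> \<Union>?U"
        ultimately show "y \<in> I \<inter> {..x}" by blast
      qed
      also have "\<Union>?U \<in> sigma_sets I E"
      proof (rule sigma_sets_UNION)
        show "countable ?U" using B D(1) by (auto intro: countable_subset[of _ D])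
        show "b \<in> sigma_sets I E" if "b \<in> ?U" for b
          using that D(2) True by (intro sigma_sets.Basic) (auto simp: E_def)
      qed
      finally show ?thesis .
    next
      case False
      \<comment> \<open>A point outside an interval has all of it on one side.\<close>
      have "I \<inter> {..x} = I \<or> I \<inter> {..x} = {}"
        using mem_is_interval_1_I[OF I, of _ _ x] False by auto (meson linear)
      then show ?thesis using sigma_sets_top sigma_sets.Empty by metis
    qed
    have "sets (restrict_space borel I) = (\<inter>) I ` sigma_sets UNIV (range atMost)"
      by (simp add: sets_restrict_space borel_eq_atMost)
    also have "\<dots> = sigma_sets I ((\<inter>) I ` range atMost)"
      using I_borel by (intro sigma_sets_Int) (auto simp: borel_eq_atMost)
    also have "\<dots> \<subseteq> sigma_sets I E"
      using atMost by (intro sigma_sets_mono) auto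
    finally show "sets (restrict_space borel I) \<subseteq> sigma_sets I E" .
  qed
  let ?A = "(\<lambda>(s, t). {s<..t}) ` {(s, t)\<in>D \<times> D. s \<le> t} \<union> B"
  show ?thesis
  proof (rule measure_eqI_generator_eq_countable[where E=E and A="?A"])
    show "Int_stable E"
    proof (rule Int_stableI)
      fix X Y assume XY: "X \<in> E" "Y \<in> E"
      have *: "{s<..t} \<inter> {s'<..t'} \<in> E" if "s \<in> I" "t \<in> I" "s' \<in> I" "t' \<in> I" "s \<le> t" "s' \<le> t'" for s t s' t'
      proof (cases "max s s' \<le> min t t'")
        case True
        moreover have "max s s' \<in> I" "min t t' \<in> I" using that by (auto simp: max_def min_def)
        moreover have "{s<..t} \<inter> {s'<..t'} = {max s s'<..min t t'}" by auto
        ultimately show ?thesis using EI by metis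
      next
        case False
        then have "{s<..t} \<inter> {s'<..t'} = {s<..s}" by auto
        also have "\<dots> \<in> E" using EI that(1) by blast
        finally show ?thesis .
      qed
      have **: "{} \<in> E" if "s \<in> I" for s using EI[of s s] that by simp
      \<comment> \<open>The singleton of the least element misses every \<open>{s<..t}\<close> with
        s in I; that mixed case is \<open>disjoint\<close>, where \<open>s\<close> serves to exhibit
        the empty set as \<open>{s<..s}\<close>.\<close>
      from XY consider (ioc) s t s' t' where "X = {s<..t}" "Y = {s'<..t'}"
          "s \<in> I" "t \<in> I" "s \<le> t" "s' \<in> I" "t' \<in> I" "s' \<le> t'"
        | (same) "X = Y" | (disjoint) s where "X \<inter> Y = {}" "s \<in> I"
        by (auto simp: E_def B_def) (metis antisym)
      then show "X \<inter> Y \<in> E"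
      proof cases
        case ioc
        show ?thesis unfolding ioc(1,2) by (rule *[OF ioc(3,4,6,7,5,8)])
      next
        case same
        then show ?thesis using XY by simp
      next
        case disjoint
        then show ?thesis using ** by simp
      qed
    qed
    show "\<Union>?A = I"
    proof (intro equalityI subsetI)
      fix y assume "y \<in> I"
      then show "y \<in> \<Union>?A" using D(3)[of y] D(4)[of y]
        by (auto simp: B_def) (meson less_le_trans less_imp_le)
    next
      fix y assume "y \<in> \<Union>?A"
      moreover have "{s<..t} \<subseteq> I" if "s \<in> D" "t \<in> D" for s t
        using Ioc[of s t] D(2) that by auto
      moreover have "\<Union>B \<subseteq> I" by (auto simp: B_def)
      ultimately show "y \<in> I" by blast
    qed
    show "countable ?A"
      using B D(1) by (auto intro!: countable_image intro: countable_subset[of _ "D \<times> D"])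
    show "emeasure M X = emeasure N X" if "X \<in> E" for X
      using that M N by (auto simp: E_def B_def is_stieltjes_measure_on_def)
    show "emeasure M a \<noteq> \<infinity>" if "a \<in> ?A" for a
      using that M D(2) by (auto simp: B_def is_stieltjes_measure_on_def subset_iff)
    show "?A \<subseteq> E" using D(2) by (auto simp: E_def)
    show "sets M = sigma_sets I E" "sets N = sigma_sets I E"
      using M N sets by (auto simp: is_stieltjes_measure_on_def)
  qed fact
qed

lemma is_stieltjes_measure_on_stieltjes_measure_on:
  assumes I: "is_interval I" and v: "mono_on I v"
    and rc: "\<And>t u y. \<lbrakk>t \<in> I; v t < y; u \<in> I; t < u\<rbrakk> \<Longrightarrow> \<exists>w\<in>I. t < w \<and> v w < y"
  shows "is_stieltjes_measure_on I v (stieltjes_measure_on I v)"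
proof -
  have "stieltjes_measure_on I v = (THE M. is_stieltjes_measure_on I v M)"
    by (simp add: stieltjes_measure_on_def is_stieltjes_measure_on_def)
  also have "is_stieltjes_measure_on I v \<dots>"
  proof (rule theI)
    show "is_stieltjes_measure_on I v (distr (restrict_space lborel {y. \<exists>s\<in>I. \<exists>t\<in>I. v s < y \<and> y \<le> v t})
        (restrict_space borel I) (\<lambda>y. Inf {t\<in>I. y \<le> v t}))"
      by (rule is_stieltjes_measure_on_quantile[OF assms])
  next
    fix M assume "is_stieltjes_measure_on I v M"
    then show "M = distr (restrict_space lborel {y. \<exists>s\<in>I. \<exists>t\<in>I. v s < y \<and> y \<le> v t})
        (restrict_space borel I) (\<lambda>y. Inf {t\<in>I. y \<le> v t})"
      using is_stieltjes_measure_on_quantile[OF assms] by (rule is_stieltjes_measure_on_unique[OF I])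
  qed
  finally show ?thesis .
qed

section \<open>The speed measure on half-open intervals and at the least element\<close>

text \<open>\<open>measure_of\<close> returns the intended values because the modified set function
  is still countably additive.\<close>

lemma emeasure_add_point_mass:
  assumes "F \<in> sets M"
  shows "emeasure (measure_of (space M) (sets M) (\<lambda>F. emeasure M F + k * indicator F a)) F =
    emeasure M F + k * indicator F a"
proof (rule emeasure_measure_of_sigma[OF sets.sigma_algebra_axioms _ _ assms])
  let ?m = "\<lambda>F. emeasure M F + k * indicator F a"
  show "positive (sets M) ?m" by (simp add: positive_def)
  show "countably_additive (sets M) ?m"
  proof (rule countably_additiveI)
    fix A :: "nat \<Rightarrow> 'a set" assume A: "range A \<subseteq> sets M" "disjoint_family A"
    have "(\<Sum>i. ?m (A i)) = (\<Sum>i. emeasure M (A i)) + (\<Sum>i. k * indicator (A i) a)"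
      by (intro suminf_add[symmetric] summableI)
    then show "(\<Sum>i. ?m (A i)) = ?m (\<Union>i. A i)"
      using A by (simp add: suminf_emeasure suminf_indicator)
  qed
qed

text \<open>These three facts replace the definition of \<open>speed_measure\<close> from here on.
  The point mass sits at the least element, which lies in no \<open>{s<..t}\<close>, so it affects
  only the third.\<close>

lemma
  assumes I: "is_interval I" and V: "mono_on I (variation_fun \<gamma> c)"
  defines "v \<equiv> right_limit_on I (variation_fun \<gamma> c)"
  shows sets_speed_measure: "sets (speed_measure I c \<gamma>) = sets (restrict_space borel I)"
    and emeasure_speed_measure_Ioc: "\<And>s t. s \<in> I \<Longrightarrow> t \<in> I \<Longrightarrow> s \<le> t \<Longrightarrow>
      emeasure (speed_measure I c \<gamma>) {s<..t} = ennreal (v t - v s)"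
    and emeasure_speed_measure_least: "\<And>a. a \<in> I \<Longrightarrow> \<forall>s\<in>I. a \<le> s \<Longrightarrow>
      emeasure (speed_measure I c \<gamma>) {a} = ennreal (v a - variation_fun \<gamma> c a)"
proof -
  define \<mu> where "\<mu> = stieltjes_measure_on I v"
  let ?\<nu> = "speed_measure I c \<gamma>"
  let ?k = "ennreal (v (Inf I) - variation_fun \<gamma> c (Inf I))"
  have "is_stieltjes_measure_on I v \<mu>"
    unfolding \<mu>_def v_def using I V
    by (intro is_stieltjes_measure_on_stieltjes_measure_on mono_on_right_limit_on)
      (meson right_limit_on_less_imp_ex)+
  then have \<mu>: "sets \<mu> = sets (restrict_space borel I)"
      "\<And>s t. s \<in> I \<Longrightarrow> t \<in> I \<Longrightarrow> s \<le> t \<Longrightarrow> emeasure \<mu> {s<..t} = ennreal (v t - v s)"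
      "\<And>a. a \<in> I \<Longrightarrow> \<forall>s\<in>I. a \<le> s \<Longrightarrow> emeasure \<mu> {a} = 0"
    by (auto simp: is_stieltjes_measure_on_def)
  have \<nu>: "?\<nu> = (if bdd_below I \<and> Inf I \<in> I
      then measure_of (space \<mu>) (sets \<mu>) (\<lambda>F. emeasure \<mu> F + ?k * indicator F (Inf I)) else \<mu>)"
    by (simp add: speed_measure_def \<mu>_def v_def Let_def)
  show sets: "sets ?\<nu> = sets (restrict_space borel I)"
    unfolding \<mu>(1)[symmetric] by (simp add: \<nu>)
  have em: "emeasure ?\<nu> F =
      emeasure \<mu> F + (if bdd_below I \<and> Inf I \<in> I then ?k * indicator F (Inf I) else 0)"
    if "F \<subseteq> I" "F \<in> sets borel" for F
  proof -
    have "F \<in> sets \<mu>"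
      using that real_interval_borel_measurable[OF I] by (simp add: \<mu>(1) sets_restrict_space_iff)
    then show ?thesis by (simp add: \<nu> emeasure_add_point_mass)
  qed
  show "emeasure ?\<nu> {s<..t} = ennreal (v t - v s)" if "s \<in> I" "t \<in> I" "s \<le> t" for s t
  proof -
    have "{s<..t} \<subseteq> I" using mem_is_interval_1_I[OF I that(1,2)] by auto
    moreover have "Inf I \<notin> {s<..t}" if "bdd_below I" using cInf_lower[OF \<open>s \<in> I\<close> that] by auto
    ultimately show ?thesis using em[of "{s<..t}"] \<mu>(2)[OF that] by auto
  qed
  show "emeasure ?\<nu> {a} = ennreal (v a - variation_fun \<gamma> c a)" if a: "a \<in> I" "\<forall>s\<in>I. a \<le> s" for a
  proof -
    have "Inf I = a" using a by (intro cInf_eq_minimum) auto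
    moreover have "bdd_below I" using a by (intro bdd_belowI) auto
    ultimately show ?thesis using em[of "{a}"] \<mu>(3)[OF a] a by simp
  qed
qed

section \<open>An \<epsilon>-\<delta> form of absolute continuity of measures\<close>

text \<open>Counterexamples \<open>B n\<close> of \<open>M\<close>-measure at most 2^-n have a
  limsup that is null for both measures. Finiteness on \<open>S\<close> gives continuity from above,
  so the \<open>N\<close>-measures of the tail unions tend to 0, although each exceeds e.\<close>

lemma absolutely_continuous_imp_small:
  fixes e :: real
  assumes sets: "sets N = sets M" and ac: "absolutely_continuous M N"
    and S: "S \<in> sets M" "emeasure N S < \<infinity>" and e: "e > 0"
  shows "\<exists>d>0. \<forall>B\<in>sets M. B \<subseteq> S \<longrightarrow> emeasure M B \<le> ennreal d \<longrightarrow> emeasure N B \<le> ennreal e"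
proof (rule ccontr)
  assume not: "\<not> ?thesis"
  have "\<exists>B. B \<in> sets M \<and> B \<subseteq> S \<and> emeasure M B \<le> ennreal d \<and> ennreal e < emeasure N B" if "d > 0" for d :: real
    using not that by (auto simp: not_le)
  then have "\<exists>B. \<forall>n. B n \<in> sets M \<and> B n \<subseteq> S \<and> emeasure M (B n) \<le> ennreal ((1/2)^n) \<and> ennreal e < emeasure N (B n)"
    by (intro choice) simp
  then obtain B where B: "\<And>n. B n \<in> sets M" "\<And>n. B n \<subseteq> S"
    "\<And>n. emeasure M (B n) \<le> ennreal ((1/2)^n)" "\<And>n. ennreal e < emeasure N (B n)"
    by blast
  have "limsup B \<in> null_sets M"
  proof (rule borel_cantelli_limsup1)
    show "emeasure M (B n) < \<infinity>" for n using B(3)[of n] by (simp add: le_less_trans)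
    have "measure M (B n) \<le> (1/2)^n" for n
      using B(3)[of n] by (simp add: measure_def enn2real_leI)
    then show "summable (\<lambda>n. measure M (B n))"
      by (intro summable_comparison_test'[OF summable_geometric[of "1/2 :: real"]]) auto
  qed (fact B)
  then have "limsup B \<in> null_sets N" using ac by (auto simp: absolutely_continuous_def)
  define C where "C n = (\<Union>i\<in>{n..}. B i)" for n
  have C: "C n \<in> sets N" "C n \<subseteq> S" for n using B by (auto simp: C_def sets)
  have "(\<lambda>n. emeasure N (C n)) \<longlonglongrightarrow> emeasure N (\<Inter>n. C n)"
  proof (rule Lim_emeasure_decseq)
    show "decseq C" unfolding C_def by (intro decseq_SucI UN_mono) auto
    show "emeasure N (C n) \<noteq> \<infinity>" for n
      using emeasure_mono[OF C(2)[of n], of N] S sets by (auto simp: top_unique)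
  qed (use C in auto)
  moreover have "(\<Inter>n. C n) = limsup B" by (simp add: C_def limsup_INF_SUP)
  ultimately have "(\<lambda>n. emeasure N (C n)) \<longlonglongrightarrow> 0"
    using \<open>limsup B \<in> null_sets N\<close> by (simp add: null_setsD1)
  moreover have "ennreal e \<le> emeasure N (C n)" for n
  proof -
    have "ennreal e \<le> emeasure N (B n)" using B(4)[of n] by simp
    also have "\<dots> \<le> emeasure N (C n)" using C by (intro emeasure_mono) (auto simp: C_def)
    finally show ?thesis .
  qed
  ultimately have "ennreal e \<le> 0" by (intro LIMSEQ_le_const) auto
  with e show False by simp
qed

section \<open>Absolute continuity of the speed measure\<close>

lemma locally_abs_continuous_imp_locally_bounded_variation:
  "locally_abs_continuous I \<gamma> \<Longrightarrow> locally_bounded_variation I \<gamma>"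
  unfolding locally_abs_continuous_def locally_bounded_variation_def
  by (blast intro: abs_continuous_on_Var_finite)

lemma locally_abs_continuous_small_variation:
  assumes "locally_abs_continuous I \<gamma>" "s \<in> I" "t \<in> I" "s \<le> t" "\<epsilon> > 0"
  obtains \<delta> where "\<delta> > 0" "small_variation_on {s..t} \<gamma> \<delta> \<epsilon>"
  using assms unfolding locally_abs_continuous_def abs_continuous_on_iff by blast

text \<open>Lets the masses of \<nu>, given by right limits, be read as variations.\<close>

lemma right_limit_on_variation_fun:
  assumes I: "is_interval I" and c: "c \<in> I" and lac: "locally_abs_continuous I \<gamma>" and t: "t \<in> I"
  shows "right_limit_on I (variation_fun \<gamma> c) t = variation_fun \<gamma> c t"
proof (rule right_limit_on_eqI[OF I _ t])
  have lbv: "locally_bounded_variation I \<gamma>"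
    using lac by (rule locally_abs_continuous_imp_locally_bounded_variation)
  then show "mono_on I (variation_fun \<gamma> c)" by (intro mono_on_variation_fun I c)
  fix u \<epsilon> :: real assume u: "u \<in> I" "t < u" "\<epsilon> > 0"
  obtain \<delta> where \<delta>: "\<delta> > 0" "small_variation_on {t..u} \<gamma> \<delta> \<epsilon>"
    using locally_abs_continuous_small_variation[OF lac t, of u \<epsilon>] u by auto
  \<comment> \<open>Capped at \<open>u\<close>, since \<delta> controls \<gamma> only on
    \<open>{t..u}\<close>.\<close>
  define w where "w = min u (t + \<delta>)"
  have w: "t < w" "w \<le> u" "w - t \<le> \<delta>" using u \<delta> by (auto simp: w_def)
  then have "w \<in> I" using mem_is_interval_1_I[OF I t u(1)] by auto
  have "ennreal (variation_fun \<gamma> c w - variation_fun \<gamma> c t) = Var \<gamma> {t..w}"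
    using I lbv c t \<open>w \<in> I\<close> w by (intro ennreal_variation_fun_diff) auto
  also have "\<dots> \<le> ennreal \<epsilon>"
    using w by (intro small_variation_on_Var_interval[OF \<delta>(2)]) auto
  finally have "variation_fun \<gamma> c w \<le> variation_fun \<gamma> c t + \<epsilon>" using u by simp
  with w \<open>w \<in> I\<close> show "\<exists>w\<in>I. t < w \<and> variation_fun \<gamma> c w \<le> variation_fun \<gamma> c t + \<epsilon>" by blast
qed

text \<open>The pieces are closed and may share endpoints, so only their interiors are disjoint.
  Writing the ends as \<open>Inf K\<close> and \<open>Sup K\<close> lets the family be indexed by
  its own members, as \<open>small_variation_on_Var\<close> permits.\<close>

lemma nonoverlapping_cover:
  fixes G :: "real set"
  assumes "G \<subseteq> {s..t}" "s < t" "open U" "G \<subseteq> U"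
  obtains \<D> where "countable \<D>" "G \<subseteq> \<Union>\<D>"
    "\<And>K. K \<in> \<D> \<Longrightarrow> K \<subseteq> U \<inter> {s..t} \<and> K = {Inf K..Sup K} \<and> Inf K < Sup K"
    "disjoint_family_on (\<lambda>K. {Inf K<..<Sup K}) \<D>"
proof -
  have "G \<subseteq> cbox s t" "box s t \<noteq> {}" using assms by auto
  \<comment> \<open>A gauge needs a neighbourhood of every point, so an arbitrary ball is used off
    \<open>U\<close>; the tags lie in \<open>G\<close>, hence in \<open>U\<close>, and never use
    it.\<close>
  moreover have "gauge (\<lambda>x. if x \<in> U then U else ball x 1)"
    using \<open>open U\<close> by (auto simp: gauge_def)
  ultimately obtain \<D> where \<D>: "countable \<D>" "\<Union>\<D> \<subseteq> cbox s t"
    "\<And>K. K \<in> \<D> \<Longrightarrow> interior K \<noteq> {} \<and> (\<exists>c d. K = cbox c d)"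
    "pairwise (\<lambda>A B. interior A \<inter> interior B = {}) \<D>"
    "\<And>K. K \<in> \<D> \<Longrightarrow> \<exists>x \<in> G \<inter> K. K \<subseteq> (if x \<in> U then U else ball x 1)"
    "G \<subseteq> \<Union>\<D>"
    by (rule covering_lemma) blast
  have K: "K = {Inf K..Sup K} \<and> Inf K < Sup K" if "K \<in> \<D>" for K
  proof -
    from \<D>(3)[OF that] obtain c d where cd: "K = {c..d}" "interior K \<noteq> {}" by auto
    then have "c < d" by auto
    then show ?thesis by (simp add: cd)
  qed
  have "interior K = {Inf K<..<Sup K}" if "K \<in> \<D>" for K
    using K[OF that] interior_atLeastAtMost_real by metis
  with \<D>(4) have disj: "disjoint_family_on (\<lambda>K. {Inf K<..<Sup K}) \<D>"
    unfolding disjoint_family_on_def pairwise_def by metis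
  have "K \<subseteq> U \<inter> {s..t}" if "K \<in> \<D>" for K
    using \<D>(2) \<D>(5)[OF that] assms(4) that by (auto split: if_splits)
  with K show thesis by (intro that[OF \<D>(1,6) _ disj]) blast
qed

text \<open>The atom at a least element is the right jump of V, and elsewhere it is bounded by the
  mass of (w, s] for w just below s. Both vanish, which allows closed intervals in place of
  half-open ones.\<close>

lemma
  assumes I: "is_interval I" and c: "c \<in> I" and lac: "locally_abs_continuous I \<gamma>"
  shows emeasure_speed_measure_singleton:
      "\<And>s. s \<in> I \<Longrightarrow> emeasure (speed_measure I c \<gamma>) {s} = 0"
    and emeasure_speed_measure_Icc: "\<And>s t. s \<in> I \<Longrightarrow> t \<in> I \<Longrightarrow> s \<le> t \<Longrightarrow>
      emeasure (speed_measure I c \<gamma>) {s..t} = Var \<gamma> {s..t}"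
proof -
  have lbv: "locally_bounded_variation I \<gamma>"
    using lac by (rule locally_abs_continuous_imp_locally_bounded_variation)
  note V = mono_on_variation_fun[OF I lbv c]
  let ?\<nu> = "speed_measure I c \<gamma>"
  have Icc: "{x..y} \<subseteq> I" if "x \<in> I" "y \<in> I" for x y
    using mem_is_interval_1_I[OF I that] by auto
  have sets: "A \<in> sets ?\<nu>" if "A \<subseteq> I" "A \<in> sets borel" for A
    using that real_interval_borel_measurable[OF I]
    by (simp add: sets_speed_measure[OF I V] sets_restrict_space_iff)
  have Ioc: "emeasure ?\<nu> {x<..y} = Var \<gamma> {x..y}" if "x \<in> I" "y \<in> I" "x \<le> y" for x y
    using that right_limit_on_variation_fun[OF I c lac] ennreal_variation_fun_diff[OF I lbv c that]
    by (simp add: emeasure_speed_measure_Ioc[OF I V])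
  show 0: "emeasure ?\<nu> {s} = 0" if s: "s \<in> I" for s
  proof (cases "\<forall>x\<in>I. s \<le> x")
    case True
    then show ?thesis
      using right_limit_on_variation_fun[OF I c lac s] s
      by (simp add: emeasure_speed_measure_least[OF I V])
  next
    case False
    then obtain x where x: "x \<in> I" "x < s" by (auto simp: not_le)
    have "emeasure ?\<nu> {s} \<le> 0 + ennreal \<epsilon>" if "\<epsilon> > 0" for \<epsilon>
    proof -
      obtain \<delta> where \<delta>: "\<delta> > 0" "small_variation_on {x..s} \<gamma> \<delta> \<epsilon>"
        using locally_abs_continuous_small_variation[OF lac x(1) s less_imp_le[OF x(2)] \<open>\<epsilon> > 0\<close>] .
      define w where "w = max x (s - \<delta>)"
      have w: "x \<le> w" "w < s" "s - w \<le> \<delta>" using x \<delta> by (auto simp: w_def)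
      then have "w \<in> I" using Icc[OF x(1) s] by auto
      have "emeasure ?\<nu> {s} \<le> emeasure ?\<nu> {w<..s}"
        using w Icc[OF \<open>w \<in> I\<close> s] by (intro emeasure_mono sets) auto
      also have "\<dots> = Var \<gamma> {w..s}" using Ioc[OF \<open>w \<in> I\<close> s] w by simp
      also have "\<dots> \<le> ennreal \<epsilon>"
        using w by (intro small_variation_on_Var_interval[OF \<delta>(2)]) auto
      finally show ?thesis by simp
    qed
    then have "emeasure ?\<nu> {s} \<le> 0" by (rule ennreal_le_epsilon)
    then show ?thesis by simp
  qed
  show "emeasure ?\<nu> {s..t} = Var \<gamma> {s..t}" if st: "s \<in> I" "t \<in> I" "s \<le> t" for s t
  proof -
    have "{s..t} = insert s {s<..t}" using st by auto
    moreover have "emeasure ?\<nu> (insert s {s<..t}) = emeasure ?\<nu> {s} + emeasure ?\<nu> {s<..t}"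
      using Icc[OF st(1,2)] st by (intro emeasure_insert sets) auto
    ultimately show ?thesis using 0[OF st(1)] Ioc[OF st] by simp
  qed
qed

lemma emeasure_speed_measure_null_Icc:
  assumes I: "is_interval I" and c: "c \<in> I" and lac: "locally_abs_continuous I \<gamma>"
    and st: "s \<in> I" "t \<in> I" "s < t"
    and G: "G \<subseteq> {s..t}" "G \<in> null_sets lborel"
  shows "emeasure (speed_measure I c \<gamma>) G = 0"
proof -
  let ?\<nu> = "speed_measure I c \<gamma>"
  have V: "mono_on I (variation_fun \<gamma> c)"
    using locally_abs_continuous_imp_locally_bounded_variation[OF lac]
    by (intro mono_on_variation_fun I c)
  have Icc: "{s..t} \<subseteq> I" using mem_is_interval_1_I[OF I st(1,2)] by auto
  have sets: "A \<in> sets ?\<nu>" if "A \<subseteq> {s..t}" "A \<in> sets borel" for A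
    using that Icc real_interval_borel_measurable[OF I]
    by (auto simp: sets_speed_measure[OF I V] sets_restrict_space_iff)
  have "emeasure ?\<nu> G \<le> 0 + ennreal \<epsilon>" if "\<epsilon> > 0" for \<epsilon>
  proof -
    obtain \<delta> where \<delta>: "\<delta> > 0" "small_variation_on {s..t} \<gamma> \<delta> \<epsilon>"
      using locally_abs_continuous_small_variation[OF lac st(1,2) less_imp_le[OF st(3)] \<open>\<epsilon> > 0\<close>] .
    have G_borel: "G \<in> sets borel" "emeasure lborel G = 0" using G(2) by auto
    obtain U where U: "open U" "G \<subseteq> U" "emeasure lborel (U - G) < \<delta>"
      using outer_regular_lborel[OF G_borel(1) \<delta>(1)] .
    have U_le: "emeasure lborel U \<le> ennreal \<delta>"
      using U emeasure_Diff_null_set[OF G(2), of U] by auto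
    obtain \<D> where \<D>: "countable \<D>" "G \<subseteq> \<Union>\<D>"
      "\<And>K. K \<in> \<D> \<Longrightarrow> K \<subseteq> U \<inter> {s..t} \<and> K = {Inf K..Sup K} \<and> Inf K < Sup K"
      "disjoint_family_on (\<lambda>K. {Inf K<..<Sup K}) \<D>"
      using nonoverlapping_cover[OF G(1) st(3) U(1,2)] by metis
    have ends: "Inf K \<in> {s..t} \<and> Sup K \<in> {s..t}" if "K \<in> \<D>" for K
    proof -
      have "Inf K \<in> {Inf K..Sup K}" "Sup K \<in> {Inf K..Sup K}" using \<D>(3)[OF that] by auto
      then have "Inf K \<in> K" "Sup K \<in> K" using \<D>(3)[OF that] by simp_all
      then show ?thesis using \<D>(3)[OF that] by blast
    qed
    have K_sets: "K \<in> sets borel" if "K \<in> \<D>" for K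
      using \<D>(3)[OF that] atLeastAtMost_borel by metis
    \<comment> \<open>Absolute continuity speaks of finite families only, so finite subfamilies are
      bounded first; continuity from below along an enumeration then reaches all of
      \<open>\<D>\<close>.\<close>
    have fin: "emeasure ?\<nu> (\<Union>\<K>) \<le> ennreal \<epsilon>" if \<K>: "finite \<K>" "\<K> \<subseteq> \<D>" for \<K>
    proof -
      have disj: "disjoint_family_on (\<lambda>K. {Inf K<..<Sup K}) \<K>"
        using \<D>(4) \<K>(2) by (rule disjoint_family_on_mono[rotated])
      \<comment> \<open>Lengths are added through the interiors, which are disjoint subsets of
        \<open>U\<close>.\<close>
      have "ennreal (\<Sum>K\<in>\<K>. Sup K - Inf K) = (\<Sum>K\<in>\<K>. ennreal (Sup K - Inf K))"
        using \<D>(3) \<K>(2) by (intro sum_ennreal[symmetric]) (meson diff_ge_0_iff_ge less_imp_le subsetD)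
      also have "\<dots> = (\<Sum>K\<in>\<K>. emeasure lborel {Inf K<..<Sup K})"
        using \<D>(3) \<K>(2) by (intro sum.cong refl emeasure_lborel_Ioo[symmetric]) (meson less_imp_le subsetD)
      also have "\<dots> = emeasure lborel (\<Union>K\<in>\<K>. {Inf K<..<Sup K})"
        using \<K>(1) disj by (intro sum_emeasure) auto
      also have "\<dots> \<le> emeasure lborel U"
      proof (rule emeasure_mono)
        have "{Inf K<..<Sup K} \<subseteq> U" if "K \<in> \<K>" for K
        proof -
          have "{Inf K..Sup K} \<subseteq> U" using \<D>(3)[of K] that \<K>(2) by blast
          then show ?thesis by auto
        qed
        then show "(\<Union>K\<in>\<K>. {Inf K<..<Sup K}) \<subseteq> U" by blast
      qed (use U(1) in auto)
      also note U_le
      finally have le: "(\<Sum>K\<in>\<K>. Sup K - Inf K) \<le> \<delta>" using \<delta>(1) by simp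
      \<comment> \<open>Subadditivity suffices, so shared endpoints do no harm.\<close>
      have "emeasure ?\<nu> (\<Union>K\<in>\<K>. K) \<le> (\<Sum>K\<in>\<K>. emeasure ?\<nu> K)"
      proof (rule emeasure_subadditive_finite[OF \<K>(1)])
        show "(\<lambda>K. K) ` \<K> \<subseteq> sets ?\<nu>" using \<D>(3) K_sets \<K>(2) by (auto intro!: sets)
      qed
      also have "\<dots> = (\<Sum>K\<in>\<K>. Var \<gamma> {Inf K..Sup K})"
      proof (rule sum.cong[OF refl])
        fix K assume "K \<in> \<K>"
        then have "K \<in> \<D>" using \<K>(2) by auto
        from ends[OF this] \<D>(3)[OF this] Icc
        have "emeasure ?\<nu> {Inf K..Sup K} = Var \<gamma> {Inf K..Sup K}"
          by (intro emeasure_speed_measure_Icc I c lac) auto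
        moreover have "{Inf K..Sup K} = K" using \<D>(3)[OF \<open>K \<in> \<D>\<close>] by simp
        ultimately show "emeasure ?\<nu> K = Var \<gamma> {Inf K..Sup K}" by simp
      qed
      also have "\<dots> \<le> ennreal \<epsilon>"
      proof (rule small_variation_on_Var[OF \<delta>(2) _ \<K>(1) _ disj le])
        show "Inf K \<in> {s..t} \<and> Sup K \<in> {s..t} \<and> Inf K \<le> Sup K" if "K \<in> \<K>" for K
          using ends[of K] \<D>(3)[of K] that \<K>(2) by (meson less_imp_le subsetD)
      qed (rule is_interval_cc)
      finally show ?thesis by simp
    qed
    have "emeasure ?\<nu> G \<le> emeasure ?\<nu> (\<Union>\<D>)"
    proof (rule emeasure_mono[OF \<D>(2)])
      show "\<Union>\<D> \<in> sets ?\<nu>" using \<D>(1,3) K_sets by (intro sets sets.countable_Union) auto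
    qed
    also have "\<dots> \<le> ennreal \<epsilon>"
    proof (cases "\<D> = {}")
      case False
      define f where "f = from_nat_into \<D>"
      have f: "range f = \<D>" unfolding f_def using False \<D>(1) by (rule range_from_nat_into)
      have "\<Union>\<D> = (\<Union>n. \<Union>(f ` {..n}))" unfolding f[symmetric] by auto
      also have "emeasure ?\<nu> \<dots> = (SUP n. emeasure ?\<nu> (\<Union>(f ` {..n})))"
      proof (rule SUP_emeasure_incseq[symmetric])
        have "\<Union>(f ` {..n}) \<in> sets ?\<nu>" for n
          using \<D>(3) K_sets f by (intro sets.finite_Union sets) auto
        then show "range (\<lambda>n. \<Union>(f ` {..n})) \<subseteq> sets ?\<nu>" by blast
        show "incseq (\<lambda>n. \<Union>(f ` {..n}))" by (intro incseq_SucI Union_mono image_mono) auto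
      qed
      also have "\<dots> \<le> ennreal \<epsilon>" using f by (intro SUP_least fin) auto
      finally show ?thesis .
    qed simp
    finally show ?thesis by simp
  qed
  then have "emeasure ?\<nu> G \<le> 0" by (rule ennreal_le_epsilon)
  then show ?thesis by simp
qed

text \<open>Every point of I other than a least element lies in some [s, t] with s < t in the
  countable set \<open>D\<close>, so F splits into countably many null pieces of the compact kind
  and at most one further point, which carries no mass.\<close>

lemma locally_abs_continuous_imp_absolutely_continuous:
  assumes I: "is_interval I" and c: "c \<in> I" and lac: "locally_abs_continuous I \<gamma>"
  shows "absolutely_continuous (restrict_space lborel I) (speed_measure I c \<gamma>)"
  unfolding absolutely_continuous_def
proof
  let ?\<nu> = "speed_measure I c \<gamma>"
  have V: "mono_on I (variation_fun \<gamma> c)"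
    using locally_abs_continuous_imp_locally_bounded_variation[OF lac]
    by (intro mono_on_variation_fun I c)
  have I_borel: "I \<in> sets borel" using I by (rule real_interval_borel_measurable)
  have sets: "A \<in> sets ?\<nu> \<longleftrightarrow> A \<subseteq> I \<and> A \<in> sets borel" for A
    using I_borel by (simp add: sets_speed_measure[OF I V] sets_restrict_space_iff)
  fix F assume "F \<in> null_sets (restrict_space lborel I)"
  then have F: "F \<subseteq> I" "F \<in> null_sets lborel"
    using I_borel by (simp_all add: null_sets_restrict_space)
  obtain D where D: "countable D" "D \<subseteq> I" "\<And>x. x \<in> I \<Longrightarrow> \<exists>t\<in>D. x \<le> t"
    "\<And>x. x \<in> I \<Longrightarrow> (\<forall>s\<in>I. x \<le> s) \<or> (\<exists>s\<in>D. s < x)"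
    using interval_countable_cofinal[OF I] by metis
  define B where "B = {a\<in>I. \<forall>s\<in>I. a \<le> s}"
  have "B \<subseteq> {Inf I}" by (auto simp: B_def intro!: cInf_eq_minimum[symmetric])
  then have "countable B" by (rule countable_subset) simp
  moreover have "{a} \<in> null_sets ?\<nu>" if "a \<in> B" for a
    using that emeasure_speed_measure_singleton[OF I c lac, of a]
    by (auto simp: B_def null_sets_def sets)
  ultimately have B: "(\<Union>a\<in>B. {a}) \<in> null_sets ?\<nu>" by (rule null_sets_UN')
  let ?P = "{(s, t)\<in>D \<times> D. s < t}"
  have P: "(\<Union>p\<in>?P. F \<inter> {fst p..snd p}) \<in> null_sets ?\<nu>"
  proof (rule null_sets_UN')
    show "countable ?P" using D(1) by (auto intro: countable_subset[of _ "D \<times> D"])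
    fix p assume "p \<in> ?P"
    then obtain s t where p: "p = (s, t)" "s \<in> I" "t \<in> I" "s < t" using D(2) by auto
    have "F \<inter> {s..t} \<in> null_sets lborel" using F(2) by (intro null_set_Int2) auto
    with emeasure_speed_measure_null_Icc[OF I c lac p(2-4), of "F \<inter> {s..t}"] F
    show "F \<inter> {fst p..snd p} \<in> null_sets ?\<nu>" by (auto simp: p null_sets_def sets)
  qed
  have "F \<subseteq> (\<Union>a\<in>B. {a}) \<union> (\<Union>p\<in>?P. F \<inter> {fst p..snd p})"
  proof
    fix x assume "x \<in> F"
    show "x \<in> (\<Union>a\<in>B. {a}) \<union> (\<Union>p\<in>?P. F \<inter> {fst p..snd p})"
    proof (cases "x \<in> B")
      case False
      then obtain s t where "s \<in> D" "s < x" "t \<in> D" "x \<le> t"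
        using D(3,4)[of x] F(1) \<open>x \<in> F\<close> by (auto simp: B_def)
      then show ?thesis using \<open>x \<in> F\<close> by (intro UnI2 UN_I[of "(s, t)"]) auto
    qed simp
  qed
  moreover have "F \<in> sets ?\<nu>" using F by (auto simp: sets)
  ultimately show "F \<in> null_sets ?\<nu>" by (intro null_sets_subset[OF null_sets.Un[OF B P]])
qed

section \<open>From the speed measure back to the map\<close>

lemma absolutely_continuous_imp_locally_abs_continuous:
  assumes I: "is_interval I" and c: "c \<in> I" and lbv: "locally_bounded_variation I \<gamma>"
    and ac: "absolutely_continuous (restrict_space lborel I) (speed_measure I c \<gamma>)"
  shows "locally_abs_continuous I \<gamma>"
proof -
  let ?\<nu> = "speed_measure I c \<gamma>" and ?V = "variation_fun \<gamma> c" and ?l = "restrict_space lborel I"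
  let ?v = "right_limit_on I ?V"
  have V: "mono_on I ?V" using I lbv c by (rule mono_on_variation_fun)
  have I_borel: "I \<in> sets borel" using I by (rule real_interval_borel_measurable)
  have sets_l: "A \<in> sets ?l \<longleftrightarrow> A \<subseteq> I \<and> A \<in> sets borel" for A
    using I_borel by (simp add: sets_restrict_space_iff)
  have sets_eq: "sets ?\<nu> = sets ?l"
    by (simp add: sets_speed_measure[OF I V] cong: sets_restrict_space_cong)
  have Ioc: "{s<..t} \<subseteq> I" if "s \<in> I" "t \<in> I" for s t
    using mem_is_interval_1_I[OF I that] by auto
  \<comment> \<open>The half-open interval has finite mass \<open>?v t - ?v s\<close>, as
    \<open>absolutely_continuous_imp_small\<close> requires.\<close>
  have small: "\<exists>d>0. \<forall>B\<in>sets ?l. B \<subseteq> {s<..t} \<longrightarrow> emeasure ?l B \<le> ennreal d \<longrightarrow> emeasure ?\<nu> B \<le> ennreal e"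
    if "s \<in> I" "t \<in> I" "s \<le> t" "e > 0" for s t e
    using that Ioc[OF that(1,2)]
    by (intro absolutely_continuous_imp_small sets_eq ac) (auto simp: sets_l emeasure_speed_measure_Ioc[OF I V])
  have em_l: "emeasure ?l A = emeasure lborel A" if "A \<subseteq> I" for A
    using I_borel that by (simp add: emeasure_restrict_space)
  have vV: "?v x = ?V x" if x: "x \<in> I" for x
  proof (cases "\<forall>s\<in>I. x \<le> s")
    case True
    \<comment> \<open>At the least element the mass of the point is exactly the jump
      \<open>?v x - ?V x\<close>.\<close>
    have "{x} \<in> null_sets ?l" using x I_borel countable_imp_null_set_lborel[of "{x}"]
      by (simp add: null_sets_restrict_space)
    then have "emeasure ?\<nu> {x} = 0" using ac by (auto simp: absolutely_continuous_def)
    then have "?v x \<le> ?V x" using emeasure_speed_measure_least[OF I V x True] by (simp add: ennreal_eq_0_iff)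
    then show ?thesis using le_right_limit_on[OF I V x] by simp
  next
    case False
    then obtain s where s: "s \<in> I" "s < x" by (auto simp: not_le)
    have "?v x \<le> ?V x + e" if "e > 0" for e
    proof -
      obtain d where d: "d > 0"
        "\<And>B. B \<in> sets ?l \<Longrightarrow> B \<subseteq> {s<..x} \<Longrightarrow> emeasure ?l B \<le> ennreal d \<Longrightarrow> emeasure ?\<nu> B \<le> ennreal e"
        using small[OF s(1) x less_imp_le[OF s(2)] \<open>e > 0\<close>] by blast
      define w where "w = max s (x - d)"
      have w: "s \<le> w" "w < x" "x - w \<le> d" using s d by (auto simp: w_def)
      then have "w \<in> I" using mem_is_interval_1_I[OF I s(1) x] by auto
      have "ennreal (?v x - ?v w) = emeasure ?\<nu> {w<..x}"
        using w x \<open>w \<in> I\<close> by (simp add: emeasure_speed_measure_Ioc[OF I V])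
      also have "\<dots> \<le> ennreal e"
        using w Ioc[OF \<open>w \<in> I\<close> x] by (intro d(2)) (auto simp: sets_l em_l)
      finally have "?v x - ?v w \<le> e" using that by simp
      \<comment> \<open>Evaluating at \<open>w\<close> below \<open>x\<close> brings
        \<open>?V x\<close> in as an upper bound; so smallness of \<nu> to the left of
        \<open>x\<close> controls the jump of \<open>?V\<close> to its right.\<close>
      moreover have "?v w \<le> ?V x" using right_limit_on_le[OF I V \<open>w \<in> I\<close> x] w by simp
      ultimately show ?thesis by simp
    qed
    then have "?v x \<le> ?V x" by (rule field_le_epsilon)
    then show ?thesis using le_right_limit_on[OF I V x] by simp
  qed
  have Var: "emeasure ?\<nu> {s<..t} = Var \<gamma> {s..t}" if "s \<in> I" "t \<in> I" "s \<le> t" for s t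
    using that ennreal_variation_fun_diff[OF I lbv c that]
    by (simp add: emeasure_speed_measure_Ioc[OF I V] vV)
  show ?thesis
    unfolding locally_abs_continuous_def abs_continuous_on_iff small_variation_on_def
  proof (intro ballI impI allI)
    fix \<alpha> \<beta> \<epsilon> :: real assume \<alpha>\<beta>: "\<alpha> \<in> I" "\<beta> \<in> I" "\<alpha> \<le> \<beta>" and "\<epsilon> > 0"
    obtain d where d: "d > 0"
      "\<And>B. B \<in> sets ?l \<Longrightarrow> B \<subseteq> {\<alpha><..\<beta>} \<Longrightarrow> emeasure ?l B \<le> ennreal d \<Longrightarrow> emeasure ?\<nu> B \<le> ennreal \<epsilon>"
      using small[OF \<alpha>\<beta> \<open>\<epsilon> > 0\<close>] by blast
    show "\<exists>\<delta>>0. \<forall>(n::nat) a b. (\<forall>k\<in>{1..n}. a k \<in> {\<alpha>..\<beta>} \<and> b k \<in> {\<alpha>..\<beta>} \<and> a k \<le> b k) \<and>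
        disjoint_family_on (\<lambda>k. {a k<..<b k}) {1..n} \<and> (\<Sum>k=1..n. b k - a k) \<le> \<delta> \<longrightarrow>
        (\<Sum>k=1..n. dist (\<gamma> (b k)) (\<gamma> (a k))) \<le> \<epsilon>"
    proof (intro exI[of _ d] conjI allI impI d(1))
      fix n :: nat and a b :: "nat \<Rightarrow> real"
      assume "(\<forall>k\<in>{1..n}. a k \<in> {\<alpha>..\<beta>} \<and> b k \<in> {\<alpha>..\<beta>} \<and> a k \<le> b k) \<and>
        disjoint_family_on (\<lambda>k. {a k<..<b k}) {1..n} \<and> (\<Sum>k=1..n. b k - a k) \<le> d"
      then have ab: "\<forall>k\<in>{1..n}. a k \<in> {\<alpha>..\<beta>} \<and> b k \<in> {\<alpha>..\<beta>} \<and> a k \<le> b k"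
        and disj: "disjoint_family_on (\<lambda>k. {a k<..<b k}) {1..n}"
        and le: "(\<Sum>k=1..n. b k - a k) \<le> d" by simp_all
      have abI: "a k \<in> I" "b k \<in> I" "a k \<le> b k" if "k \<in> {1..n}" for k
        using ab that mem_is_interval_1_I[OF I \<alpha>\<beta>(1,2)] by auto
      let ?B = "\<Union>k\<in>{1..n}. {a k<..b k}"
      have sub: "?B \<subseteq> {\<alpha><..\<beta>}" using ab by fastforce
      have sets_ab: "{a k<..b k} \<in> sets ?l" if "k \<in> {1..n}" for k
        using Ioc[of "a k" "b k"] abI[OF that] by (auto simp: sets_l)
      \<comment> \<open>Half-open intervals are what \<nu> measures by variation; they inherit
        disjointness, degenerate ones being empty.\<close>
      have disj': "disjoint_family_on (\<lambda>k. {a k<..b k}) {1..n}"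
        unfolding disjoint_family_on_def
      proof (intro ballI impI)
        fix i j assume "i \<in> {1..n}" "j \<in> {1..n}" "i \<noteq> j"
        then have "{a i<..<b i} \<inter> {a j<..<b j} = {}" using disj by (auto simp: disjoint_family_on_def)
        then have "min (b i) (b j) \<le> max (a i) (a j)" by simp
        then show "{a i<..b i} \<inter> {a j<..b j} = {}" by auto
      qed
      have "ennreal (\<Sum>k=1..n. dist (\<gamma> (b k)) (\<gamma> (a k))) = (\<Sum>k=1..n. ennreal (dist (\<gamma> (a k)) (\<gamma> (b k))))"
        by (simp add: sum_ennreal dist_commute)
      also have "\<dots> \<le> (\<Sum>k=1..n. Var \<gamma> {a k..b k})"
        by (intro sum_mono dist_le_Var abI)
      also have "\<dots> = (\<Sum>k=1..n. emeasure ?\<nu> {a k<..b k})"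
        by (intro sum.cong refl Var[symmetric] abI)
      also have "\<dots> = emeasure ?\<nu> ?B"
        using sets_ab disj' by (intro sum_emeasure) (auto simp: sets_eq)
      also have "\<dots> \<le> ennreal \<epsilon>"
      proof (rule d(2)[OF _ sub])
        show "?B \<in> sets ?l" using sets_ab by (intro sets.finite_UN) auto
        have "emeasure ?l ?B = (\<Sum>k=1..n. emeasure ?l {a k<..b k})"
          using sets_ab disj' by (intro sum_emeasure[symmetric]) auto
        also have "\<dots> = (\<Sum>k=1..n. ennreal (b k - a k))"
          by (intro sum.cong refl) (simp add: em_l Ioc abI)
        also have "\<dots> = ennreal (\<Sum>k=1..n. b k - a k)"
          by (intro sum_ennreal) (simp add: abI)
        also have "\<dots> \<le> ennreal d" using le by (rule ennreal_leI)
        finally show "emeasure ?l ?B \<le> ennreal d" .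
      qed
      finally show "(\<Sum>k=1..n. dist (\<gamma> (b k)) (\<gamma> (a k))) \<le> \<epsilon>" using \<open>\<epsilon> > 0\<close> by simp
    qed
  qed
qed

theorem theorem3p2:
  fixes I :: "real set" and c :: real and \<gamma> :: "real \<Rightarrow> 'a::metric_space"
  assumes "connected I" and "I \<noteq> {} \<Longrightarrow> c \<in> I"
  shows "locally_abs_continuous I \<gamma> \<longleftrightarrow>
    locally_bounded_variation I \<gamma> \<and>
    absolutely_continuous (restrict_space lborel I) (speed_measure I c \<gamma>)"
proof (cases "I = {}")
  \<comment> \<open>No base point exists here; the empty set is the only null set to check, and it
    is null for every measure.\<close>
  case True
  then show ?thesis
    by (auto simp: locally_abs_continuous_def locally_bounded_variation_def
        absolutely_continuous_def null_sets_restrict_space)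
next
  case False
  have I: "is_interval I" using assms(1) by (simp add: is_interval_connected_1)
  show ?thesis
    using assms(2)[OF False] locally_abs_continuous_imp_locally_bounded_variation
      locally_abs_continuous_imp_absolutely_continuous[OF I]
      absolutely_continuous_imp_locally_abs_continuous[OF I] by blast
qed

end
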